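(* Let $\varepsilon>0$ and consider $$\varepsilon^2u''=u^3-\lambda u+\cos t. \qquad (E)$$ Suppose $\lambda>\lambda_0=3/2^{2/3}$, and let $u_1$ and $u_5$ be the unique solutions of (E) with $u'(0)=0$ that are bounded on $[0,\infty)$ and satisfy, respectively, $u_1<0,\ 3u_1^2-\lambda>0$ and $u_5>0,\ 3u_5^2-\lambda>0$ on $[0,\infty)$. Then $u_1$ and $u_5$ are $2\pi$-periodic, $u_1'>0$ in $(0,\pi)$, and $\underline U(0)<u_1(t)<\underline U(\pi)$ for $t\in[0,\pi]$. Also $u_5(t)=-u_1(t+\pi)$, and $u_1$ and $u_5$ are the minimal and maximal bounded solutions of (E) on $(-\infty,\infty)$, in the sense that every other solution of (E) bounded on $(-\infty,\infty)$ lies between these two. Also there is a third $2\pi$-periodic solution $u_p$ of (E), with $u_p'(0)=0$, which satisfies $u_p(\pi/2)=0$ and $u_p'>0$ on $(0,\pi/2)$. A unique solution with these properties exists for all $\lambda\in\mathbb{R}$ (and so for $\lambda\le0$ it is the unique solution of (E) with $u'(0)=0$ that is bounded on $[0,\infty)$).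
   Context: For $\lambda>\lambda_0=3/2^{2/3}$ the equation $u^3-\lambda u+\cos t=0$ has, for each $t$, exactly three real roots, denoted $\bar U(t)>U_0(t)>\underline U(t)$. The existence and uniqueness of $u_1$ and $u_5$ as described may be taken as known (it is an earlier proposition of the paper). *)

theory Defs
  imports "HOL-Analysis.Analysis"
begin

text \<open>Solutions live on the whole line. For solutions with \<open>u'(0) = 0\<close> that are required to exist on
  \<open>[0, \<infinity>)\<close> this is no restriction: the equation is invariant under \<open>t \<mapsto> -t\<close>, so such a solution
  extends (uniquely) to an even solution on the whole line.\<close>

definition is_solution :: "real \<Rightarrow> real \<Rightarrow> (real \<Rightarrow> real) \<Rightarrow> bool" where
  "is_solution eps lam u \<longleftrightarrow>
     (\<forall>t. u differentiable (at t)) \<and>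
     (\<forall>t. deriv u differentiable (at t)) \<and>
     (\<forall>t. eps^2 * deriv (deriv u) t = (u t)^3 - lam * u t + cos t)"

definition bounded_half_line_solution :: "real \<Rightarrow> real \<Rightarrow> (real \<Rightarrow> real) \<Rightarrow> bool" where
  "bounded_half_line_solution eps lam u \<longleftrightarrow>
     is_solution eps lam u \<and> deriv u 0 = 0 \<and> bounded (u ` {0..})"

definition bounded_solution :: "real \<Rightarrow> real \<Rightarrow> (real \<Rightarrow> real) \<Rightarrow> bool" where
  "bounded_solution eps lam u \<longleftrightarrow> is_solution eps lam u \<and> bounded (range u)"

definition periodic_2pi :: "(real \<Rightarrow> real) \<Rightarrow> bool" where
  "periodic_2pi u \<longleftrightarrow> (\<forall>t. u (t + 2 * pi) = u t)"

text \<open>The least of the three real roots; meaningful when there are exactly three, as is the case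
  for every \<open>t\<close> if \<open>lam > 3 / 2 powr (2/3)\<close>.\<close>

definition U_lower :: "real \<Rightarrow> real \<Rightarrow> real" where
  "U_lower lam t = (THE x. \<exists>y z. x < y \<and> y < z \<and> {u. u^3 - lam * u + cos t = 0} = {x, y, z})"

definition is_up :: "real \<Rightarrow> real \<Rightarrow> (real \<Rightarrow> real) \<Rightarrow> bool" where
  "is_up eps lam u \<longleftrightarrow>
     is_solution eps lam u \<and> periodic_2pi u \<and> deriv u 0 = 0 \<and>
     u (pi/2) = 0 \<and> (\<forall>t\<in>{0<..<pi/2}. deriv u t > 0)"

end

theory Submission
  imports Defs
begin

text \<open>
  Everything rests on one-dimensional comparison arguments. If \<open>w\<close> is the difference of two
  solutions, then \<open>eps\<^sup>2 w'' = (u\<^sup>2 + u v + v\<^sup>2 - lam) w\<close>. Where \<open>w\<close> is negative and the coefficient is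
  positive, \<open>w\<close> is concave, so a bounded \<open>w\<close> cannot become negative. This gives minimality of \<open>u1\<close>,
  hence its uniqueness, and then periodicity and the relation to \<open>u5\<close> follow from the symmetries
  of the equation. Monotonicity is the minimum principle for \<open>u1'\<close>, and the bounds by the roots are
  Hopf's lemma for \<open>u1'\<close> at \<open>0\<close> and \<open>pi\<close>.

  On \<open>[0, pi/2]\<close> the problem \<open>u'(0) = 0, u(pi/2) = 0\<close> has the upper solution \<open>0\<close> and the lower
  solution \<open>-(1 + |lam|)\<close>; monotone iteration with an explicit Green function yields a
  nonpositive solution, which extends to the line by reflection. Uniqueness is the
  Brezis-Oswald argument: for two negative solutions the Wronskian of the pair is strictly monotone
  between crossings. Since \<open>-u\<close> is a positive strict supersolution of the linearized operator, the
  same Wronskian comparison applied to \<open>u'\<close> shows \<open>u' > 0\<close>.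
\<close>

section \<open>Second-order differential inequalities\<close>

text \<open>If \<open>d < 0\<close>, then \<open>g'\<close> is negative just to the right of its
  zero \<open>x\<close>, and the mean value theorem makes \<open>g\<close> drop below
  \<open>g x\<close>.\<close>

lemma second_deriv_at_local_min:
  fixes g g' :: "real \<Rightarrow> real"
  assumes g: "\<And>t. (g has_real_derivative g' t) (at t)"
    and g': "(g' has_real_derivative d) (at x)"
    and e: "e > 0" and min: "\<And>y. \<bar>y - x\<bar> < e \<Longrightarrow> g x \<le> g y"
  shows "g' x = 0" and "d \<ge> 0"
proof -
  show g'x: "g' x = 0"
    by (rule DERIV_local_min[OF g e]) (use min in \<open>auto simp: abs_minus_commute\<close>)
  show "d \<ge> 0"
  proof (rule ccontr)
    assume "\<not> d \<ge> 0"
    then obtain r where r: "r > 0" "\<And>h. 0 < h \<Longrightarrow> h < r \<Longrightarrow> g' (x + h) < g' x"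
      using DERIV_neg_dec_right[OF g'] by force
    define h where "h = min e r / 2"
    have h: "0 < h" "h < e" "h < r"
      using e r by (auto simp: h_def)
    obtain y where y: "x < y" "y < x + h" "g (x + h) - g x = (x + h - x) * g' y"
      using MVT2[of x "x + h" g g'] g h by auto
    have "g' (x + (y - x)) < g' x"
      by (rule r) (use y h in auto)
    then have "h * g' y < 0"
      using h g'x by (simp add: mult_pos_neg)
    then have "g (x + h) < g x"
      using y by simp
    with min[of "x + h"] h show False by simp
  qed
qed

lemma second_deriv_at_local_max:
  fixes g g' :: "real \<Rightarrow> real"
  assumes g: "\<And>t. (g has_real_derivative g' t) (at t)"
    and g': "(g' has_real_derivative d) (at x)"
    and "e > 0" and "\<And>y. \<bar>y - x\<bar> < e \<Longrightarrow> g y \<le> g x"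
  shows "g' x = 0" and "d \<le> 0"
  using second_deriv_at_local_min[of "\<lambda>t. - g t" "\<lambda>t. - g' t" "- d" x e] assms
  by (auto intro!: derivative_eq_intros)

lemma first_zero:
  fixes z :: "real \<Rightarrow> real"
  assumes cont: "continuous_on UNIV z" and "z a < 0" "z c \<ge> 0" "a < c"
  obtains b where "a < b" "b \<le> c" "z b = 0" "\<And>t. a \<le> t \<Longrightarrow> t < b \<Longrightarrow> z t < 0"
proof -
  have "closed {t. 0 \<le> z t}"
    by (rule closed_Collect_le) (use cont in auto)
  then have "compact ({a..c} \<inter> {t. 0 \<le> z t})"
    by (rule compact_Int_closed[OF compact_Icc])
  moreover have "c \<in> {a..c} \<inter> {t. 0 \<le> z t}"
    using assms by auto
  ultimately obtain b where b: "b \<in> {a..c}" "0 \<le> z b"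
    and min: "\<And>t. t \<in> {a..c} \<Longrightarrow> 0 \<le> z t \<Longrightarrow> b \<le> t"
    using compact_attains_inf[of "{a..c} \<inter> {t. 0 \<le> z t}"] by blast
  have neg: "z t < 0" if "a \<le> t" "t < b" for t
    using min[of t] b that by force
  have "a < b"
    using b assms by (cases "a = b") auto
  obtain x where "a \<le> x" "x \<le> b" "z x = 0"
    using IVT'[of z a 0 b] assms b continuous_on_subset[OF cont] by force
  then have "z b = 0"
    using neg[of x] by (cases "x = b") auto
  with that[of b] neg \<open>a < b\<close> b show ?thesis by auto
qed

lemma last_zero:
  fixes z :: "real \<Rightarrow> real"
  assumes cont: "continuous_on UNIV z" and "z c < 0" "z a \<ge> 0" "a < c"
  obtains b where "a \<le> b" "b < c" "z b = 0" "\<And>t. b < t \<Longrightarrow> t \<le> c \<Longrightarrow> z t < 0"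
proof -
  have "continuous_on UNIV (\<lambda>t. z (- t))"
    by (intro continuous_on_compose2[OF cont] continuous_intros) auto
  then obtain b where b: "- c < b" "b \<le> - a" "z (- b) = 0"
    and neg: "\<And>t. - c \<le> t \<Longrightarrow> t < b \<Longrightarrow> z (- t) < 0"
    using first_zero[of "\<lambda>t. z (- t)" "- c" "- a"] assms by auto
  show ?thesis
    using that[of "- b"] b neg[of "- t" for t] by auto
qed

text \<open>While \<open>w\<close> is negative its slope decreases from a nonpositive value, so
  \<open>w\<close> never returns to 0 and ends up below a line of negative slope, against
  boundedness.\<close>

lemma concave_where_negative_escapes:
  fixes w w' w'' :: "real \<Rightarrow> real"
  assumes w: "\<And>t. (w has_real_derivative w' t) (at t)"
    and w': "\<And>t. (w' has_real_derivative w'' t) (at t)"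
    and concave: "\<And>t. t \<ge> a \<Longrightarrow> w t < 0 \<Longrightarrow> w'' t < 0"
    and bdd: "bounded (w ` {a..})"
    and a: "w a < 0" "w' a \<le> 0"
  shows False
proof -
  have cont: "continuous_on UNIV w"
    by (meson w DERIV_isCont continuous_at_imp_continuous_on)
  have neg: "w t < 0" if "t \<ge> a" for t
  proof (rule ccontr)
    assume "\<not> w t < 0"
    then have "w t \<ge> 0" "a < t"
      using a that by (auto simp: less_le)
    then obtain b where b: "a < b" "w b = 0" and neg: "\<And>t. a \<le> t \<Longrightarrow> t < b \<Longrightarrow> w t < 0"
      using first_zero[OF cont, of a t] a(1) by metis
    have "w' s \<le> 0" if "a \<le> s" "s < b" for s
      using DERIV_nonpos_imp_nonincreasing[OF that(1), of w'] a w' concave neg that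
      by (meson less_imp_le order_le_less_trans order_trans)
    then have "(b - a) * w' s \<le> 0" if "a < s" "s < b" for s
      using that by (simp add: mult_nonneg_nonpos)
    then have "w b - w a \<le> 0"
      using MVT2[of a b w w'] b(1) w by metis
    with a b show False by simp
  qed
  \<comment> \<open>The slope at \<open>a\<close> may be 0; one unit of time makes it strictly
    negative, which supplies the linear rate \<open>d\<close>.\<close>
  have "w' (a + 1) < w' a"
    using DERIV_neg_imp_decreasing[of a "a + 1" w'] w' concave neg by (meson less_add_one)
  define d where "d = - w' (a + 1)"
  have d: "d > 0"
    using \<open>w' (a + 1) < w' a\<close> a by (simp add: d_def)
  have w'd: "w' t \<le> - d" if "t \<ge> a + 1" for t
    using DERIV_nonpos_imp_nonincreasing[OF that, of w'] w' concave neg that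
    by (fastforce simp: d_def intro: less_imp_le)
  have lin: "w t \<le> w (a + 1) - d * (t - (a + 1))" if "t \<ge> a + 1" for t
  proof -
    have "(\<lambda>t. w t + d * t) t \<le> (\<lambda>t. w t + d * t) (a + 1)"
      by (rule DERIV_nonpos_imp_nonincreasing[OF that])
        (use w w'd in \<open>force intro!: derivative_eq_intros\<close>)
    then show ?thesis by (simp add: algebra_simps)
  qed
  obtain B where B: "\<And>t. t \<ge> a \<Longrightarrow> \<bar>w t\<bar> \<le> B"
    using bdd by (auto simp: bounded_iff)
  \<comment> \<open>By this time the line has dropped by \<open>B + 1\<close>, so \<open>w t\<close>
    lies below \<open>- B\<close>.\<close>
  define t where "t = a + 1 + (B + 1) / d"
  have "B \<ge> 0" using B[of a] by simp
  then have t: "t \<ge> a + 1" using d by (simp add: t_def)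
  have "w t \<le> w (a + 1) - (B + 1)"
    using lin[OF t] d by (simp add: t_def)
  with B[of t] t neg[of "a + 1"] show False by simp
qed

text \<open>From a negative value \<open>w\<close> escapes forwards if its slope there is
  nonpositive, and backwards otherwise; the second case is the first after reflecting time.\<close>

lemma bounded_concave_where_negative:
  fixes w w' w'' :: "real \<Rightarrow> real"
  assumes w: "\<And>t. (w has_real_derivative w' t) (at t)"
    and w': "\<And>t. (w' has_real_derivative w'' t) (at t)"
    and concave: "\<And>t. w t < 0 \<Longrightarrow> w'' t < 0"
    and bdd: "bounded (range w)"
  shows "w t \<ge> 0"
proof (rule ccontr)
  assume "\<not> w t \<ge> 0"
  then have neg: "w t < 0" by simp
  show False
  proof (cases "w' t \<le> 0")
    case True
    show ?thesis
      by (rule concave_where_negative_escapes[OF w w' concave _ neg True])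
        (use bdd in \<open>auto intro: bounded_subset\<close>)
  next
    case False
    have D1: "((\<lambda>s. w (- s)) has_real_derivative - w' (- s)) (at s)" for s
      by (rule DERIV_mirror[THEN iffD1, OF w])
    have D2: "((\<lambda>s. - w' (- s)) has_real_derivative w'' (- s)) (at s)" for s
      using DERIV_minus[OF w'[of "- s", unfolded DERIV_mirror]] by simp
    show ?thesis
      by (rule concave_where_negative_escapes[OF D1 D2, of "- t"])
        (use bdd neg concave False in \<open>auto intro: bounded_subset\<close>)
  qed
qed

text \<open>The operator \<open>D\<^sup>2 - k\<^sup>2\<close> factors as
  \<open>(D + k) (D - k)\<close>, so two first-order Gronwall arguments suffice: first for
  \<open>w' - k * w\<close> with weight \<open>exp (k * t)\<close>, then for \<open>w\<close> with
  weight \<open>exp (- k * t)\<close>.\<close>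

lemma second_order_gronwall:
  fixes w w' w'' :: "real \<Rightarrow> real"
  assumes w: "\<And>t. (w has_real_derivative w' t) (at t)"
    and w': "\<And>t. (w' has_real_derivative w'' t) (at t)"
    and le: "\<And>t. a \<le> t \<Longrightarrow> t \<le> b \<Longrightarrow> w'' t \<le> k\<^sup>2 * w t"
    and a: "w a \<le> 0" "w' a \<le> k * w a" and t: "a \<le> t" "t \<le> b"
  shows "w t \<le> 0"
proof -
  have y: "w' s \<le> k * w s" if s: "a \<le> s" "s \<le> b" for s
  proof -
    have "(\<lambda>t. exp (k * t) * (w' t - k * w t)) s \<le> (\<lambda>t. exp (k * t) * (w' t - k * w t)) a"
    proof (rule DERIV_nonpos_imp_nonincreasing[OF s(1)], intro exI conjI)
      fix x assume x: "a \<le> x" "x \<le> s"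
      show "((\<lambda>t. exp (k * t) * (w' t - k * w t)) has_real_derivative
          exp (k * x) * (w'' x - k\<^sup>2 * w x)) (at x)"
        by (rule derivative_eq_intros w w' refl)+ (simp add: algebra_simps power2_eq_square)
      show "exp (k * x) * (w'' x - k\<^sup>2 * w x) \<le> 0"
        using le[of x] x s by (simp add: mult_nonneg_nonpos)
    qed
    also have "\<dots> \<le> 0"
      using a by (simp add: mult_nonneg_nonpos)
    finally show ?thesis
      by (simp add: mult_le_0_iff)
  qed
  have "(\<lambda>t. exp (- k * t) * w t) t \<le> (\<lambda>t. exp (- k * t) * w t) a"
  proof (rule DERIV_nonpos_imp_nonincreasing[OF t(1)], intro exI conjI)
    fix x assume x: "a \<le> x" "x \<le> t"
    show "((\<lambda>t. exp (- k * t) * w t) has_real_derivative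
        exp (- k * x) * (w' x - k * w x)) (at x)"
      by (rule derivative_eq_intros w w' refl)+ (simp add: algebra_simps)
    show "exp (- k * x) * (w' x - k * w x) \<le> 0"
      using y[of x] x t by (simp add: mult_nonneg_nonpos)
  qed
  also have "\<dots> \<le> 0"
    using a by (simp add: mult_nonneg_nonpos)
  finally show ?thesis
    by (simp add: mult_le_0_iff)
qed

text \<open>The weight \<open>p\<close> may vanish at \<open>b\<close>; hence the Wronskian rather than the quotient \<open>z / p\<close>.\<close>

lemma wronskian_comparison:
  fixes z z' z'' p p' p'' :: "real \<Rightarrow> real"
  assumes z: "\<And>t. (z has_real_derivative z' t) (at t)" "\<And>t. (z' has_real_derivative z'' t) (at t)"
    and p: "\<And>t. (p has_real_derivative p' t) (at t)" "\<And>t. (p' has_real_derivative p'' t) (at t)"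
    and pos: "\<And>t. t \<in> {0..b} \<Longrightarrow> p t \<ge> 0"
    and wronsk: "\<And>t. t \<in> {0<..<b} \<Longrightarrow> z t < 0 \<Longrightarrow> z'' t * p t - z t * p'' t < 0"
    and left: "z 0 \<ge> 0 \<or> z' 0 = 0 \<and> p' 0 = 0" and right: "z b \<ge> 0"
    and t: "t \<in> {0..b}"
  shows "z t \<ge> 0"
proof (rule ccontr)
  assume "\<not> z t \<ge> 0"
  then have zt: "z t < 0" by simp
  have cont: "continuous_on UNIV z"
    by (meson z(1) DERIV_isCont continuous_at_imp_continuous_on)
  define W where "W = (\<lambda>t. z' t * p t - z t * p' t)"
  have W: "(W has_real_derivative z'' t * p t - z t * p'' t) (at t)" for t
    unfolding W_def by (rule derivative_eq_intros z p refl)+ (simp add: algebra_simps)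
  have "t < b" using zt right t by (cases "t = b") auto
  then obtain d where d: "t < d" "d \<le> b" "z d = 0" and dneg: "\<And>s. t \<le> s \<Longrightarrow> s < d \<Longrightarrow> z s < 0"
    using first_zero[OF cont zt right] by auto
  \<comment> \<open>At \<open>d\<close> the function \<open>z\<close> reaches 0 from below, so
    \<open>z' d \<ge> 0\<close> and only \<open>z' d * p d\<close> remains of
    \<open>W d\<close>.\<close>
  have Wd: "W d \<ge> 0"
  proof -
    have "z' d \<ge> 0"
    proof (rule ccontr)
      assume "\<not> z' d \<ge> 0"
      then obtain r where "r > 0" and r: "\<And>h. 0 < h \<Longrightarrow> h < r \<Longrightarrow> z d < z (d - h)"
        using DERIV_neg_dec_left[OF z(1), of d] by force
      define h where "h = min r (d - t) / 2"
      have "0 < h" "h < r" "h < d - t"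
        using \<open>r > 0\<close> d by (auto simp: h_def)
      with r[of h] dneg[of "d - h"] d show False
        by auto
    qed
    then show ?thesis using pos[of d] d t by (simp add: W_def)
  qed
  \<comment> \<open>\<open>c\<close> is the left end of the interval of negativity. It is either a
    zero of \<open>z\<close>, where \<open>z' c \<le> 0\<close>, or the point 0 with
    \<open>z 0 < 0\<close>, where the derivative alternative of \<open>left\<close> gives
    \<open>W 0 = 0\<close>.\<close>
  obtain c where c: "0 \<le> c" "c \<le> t" "c < d" "W c \<le> 0" and cneg: "\<And>s. c < s \<Longrightarrow> s \<le> t \<Longrightarrow> z s < 0"
  proof (cases "\<exists>s. 0 \<le> s \<and> s \<le> t \<and> z s \<ge> 0")
    case True
    then obtain s where s: "0 \<le> s" "s \<le> t" "z s \<ge> 0" by blast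
    then obtain c where c: "s \<le> c" "c < t" "z c = 0" and cneg: "\<And>s. c < s \<Longrightarrow> s \<le> t \<Longrightarrow> z s < 0"
      using last_zero[OF cont zt s(3)] zt by (metis less_le not_less)
    have "z' c \<le> 0"
    proof (rule ccontr)
      assume "\<not> z' c \<le> 0"
      then obtain r where "r > 0" and r: "\<And>h. 0 < h \<Longrightarrow> h < r \<Longrightarrow> z c < z (c + h)"
        using DERIV_pos_inc_right[OF z(1), of c] by force
      define h where "h = min r (t - c) / 2"
      have "0 < h" "h < r" "h < t - c"
        using \<open>r > 0\<close> c by (auto simp: h_def)
      with r[of h] cneg[of "c + h"] c show False
        by auto
    qed
    then have "W c \<le> 0"
      using pos[of c] c s t by (simp add: W_def mult_nonpos_nonneg)
    with that[of c] c s d cneg show ?thesis by auto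
  next
    case False
    then have "z 0 < 0" "\<And>s. 0 < s \<Longrightarrow> s \<le> t \<Longrightarrow> z s < 0" using t by force+
    with that[of 0] left t d show ?thesis by (auto simp: W_def)
  qed
  \<comment> \<open>\<open>W\<close> has negative derivative on the interval from \<open>c\<close>
    to \<open>d\<close>, yet goes from a nonpositive to a nonnegative value.\<close>
  obtain s where s: "c < s" "s < d" "W d - W c = (d - c) * (z'' s * p s - z s * p'' s)"
    using MVT2[OF c(3) W] by blast
  have "z s < 0"
    using cneg[of s] dneg[of s] s by linarith
  then have "z'' s * p s - z s * p'' s < 0"
    using wronsk[of s] s c d by simp
  with s c Wd show False
    by (smt (verit) mult_pos_neg)
qed

section \<open>Solutions and their symmetries\<close>

text \<open>The energy \<open>w\<^sup>2 + w'\<^sup>2\<close> has derivative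
  \<open>2 * (1 + c) * w * w'\<close>, at most \<open>1 + C\<close> times itself when
  \<open>C\<close> bounds \<open>\<bar>c\<bar>\<close> on the compact interval. Discounted by
  \<open>exp (- (1 + C) * s)\<close> it is nonincreasing and stays 0. Times before \<open>a\<close>
  are handled by reflection.\<close>

lemma linear_ode_zero:
  fixes w w' c :: "real \<Rightarrow> real"
  assumes w: "\<And>t. (w has_real_derivative w' t) (at t)"
    and w': "\<And>t. (w' has_real_derivative c t * w t) (at t)"
    and c: "continuous_on UNIV c" and a: "w a = 0" "w' a = 0"
  shows "w t = 0"
proof -
  have forward: "w t = 0" if w: "\<And>t. (w has_real_derivative w' t) (at t)"
    and w': "\<And>t. (w' has_real_derivative c t * w t) (at t)"
    and c: "continuous_on UNIV c" and a: "w a = 0" "w' a = 0" and t: "a \<le> t"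
    for w w' c :: "real \<Rightarrow> real" and a t
  proof -
    have "compact (c ` {a..t})"
      by (rule compact_continuous_image[OF continuous_on_subset[OF c]]) auto
    then obtain C where "\<forall>x\<in>c ` {a..t}. norm x \<le> C"
      using compact_imp_bounded bounded_iff by blast
    then have C: "\<And>s. s \<in> {a..t} \<Longrightarrow> \<bar>c s\<bar> \<le> C" by simp
    define e where "e s = exp (- (1 + C) * s) * ((w s)\<^sup>2 + (w' s)\<^sup>2)" for s
    have "e t \<le> e a"
    proof (rule DERIV_nonpos_imp_nonincreasing[OF t], intro exI conjI)
      fix s assume s: "a \<le> s" "s \<le> t"
      show "(e has_real_derivative exp (- (1 + C) * s) *
          (2 * (1 + c s) * (w s * w' s) - (1 + C) * ((w s)\<^sup>2 + (w' s)\<^sup>2))) (at s)"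
        unfolding e_def[abs_def]
        by (rule derivative_eq_intros w w' refl)+ (simp add: algebra_simps power2_eq_square)
      have "2 * \<bar>w s * w' s\<bar> \<le> (w s)\<^sup>2 + (w' s)\<^sup>2"
        using sum_squares_bound[of "\<bar>w s\<bar>" "\<bar>w' s\<bar>"] by (simp add: abs_mult)
      moreover have "\<bar>1 + c s\<bar> \<le> 1 + C" using C[of s] s by auto
      ultimately have "\<bar>1 + c s\<bar> * (2 * \<bar>w s * w' s\<bar>) \<le> (1 + C) * ((w s)\<^sup>2 + (w' s)\<^sup>2)"
        by (intro mult_mono) auto
      then have "2 * (1 + c s) * (w s * w' s) \<le> (1 + C) * ((w s)\<^sup>2 + (w' s)\<^sup>2)"
        using abs_ge_self[of "(1 + c s) * (2 * (w s * w' s))"]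
        by (simp only: abs_mult mult_ac abs_numeral)
      then show "exp (- (1 + C) * s) *
          (2 * (1 + c s) * (w s * w' s) - (1 + C) * ((w s)\<^sup>2 + (w' s)\<^sup>2)) \<le> 0"
        by (simp add: mult_nonneg_nonpos)
    qed
    also have "e a = 0" using a by (simp add: e_def)
    finally have "(w t)\<^sup>2 + (w' t)\<^sup>2 \<le> 0"
      by (simp add: e_def mult_le_0_iff)
    then show ?thesis by (simp add: sum_power2_le_zero_iff)
  qed
  show ?thesis
  proof (cases "a \<le> t")
    case True
    then show ?thesis using forward[OF w w' c a] by blast
  next
    case False
    have D1: "((\<lambda>s. w (- s)) has_real_derivative - w' (- s)) (at s)" for s
      by (rule DERIV_mirror[THEN iffD1, OF w])
    have D2: "((\<lambda>s. - w' (- s)) has_real_derivative c (- s) * w (- s)) (at s)" for s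
      using DERIV_minus[OF w'[of "- s", unfolded DERIV_mirror]] by simp
    have "continuous_on UNIV (\<lambda>s. c (- s))"
      by (intro continuous_on_compose2[OF c] continuous_intros) auto
    from forward[OF D1 D2 this, of "- a" "- t"] a False show ?thesis by simp
  qed
qed

lemma solution_derivs:
  assumes "is_solution eps lam u" and "eps > 0"
  shows "(u has_real_derivative deriv u t) (at t)"
    and "(deriv u has_real_derivative ((u t)^3 - lam * u t + cos t) / eps\<^sup>2) (at t)"
proof -
  show "(u has_real_derivative deriv u t) (at t)"
    using assms by (simp add: is_solution_def DERIV_deriv_iff_real_differentiable)
  have "deriv (deriv u) t = ((u t)^3 - lam * u t + cos t) / eps\<^sup>2"
    using assms by (simp add: is_solution_def field_simps)
  moreover have "(deriv u has_real_derivative deriv (deriv u) t) (at t)"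
    using assms by (simp add: is_solution_def DERIV_deriv_iff_real_differentiable)
  ultimately show "(deriv u has_real_derivative ((u t)^3 - lam * u t + cos t) / eps\<^sup>2) (at t)"
    by simp
qed

lemma is_solutionI:
  assumes u: "\<And>t. (u has_real_derivative u' t) (at t)"
    and u': "\<And>t. (u' has_real_derivative ((u t)^3 - lam * u t + cos t) / eps\<^sup>2) (at t)"
    and "eps > 0"
  shows "is_solution eps lam u" and "deriv u = u'"
proof -
  show d: "deriv u = u'"
    using u by (auto intro: DERIV_imp_deriv)
  have "deriv (deriv u) t = ((u t)^3 - lam * u t + cos t) / eps\<^sup>2" for t
    unfolding d by (rule DERIV_imp_deriv[OF u'])
  with u u' d \<open>eps > 0\<close> show "is_solution eps lam u"
    by (auto simp: is_solution_def real_differentiable_def)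
qed

lemma solution_continuous:
  assumes "is_solution eps lam u"
  shows "continuous_on A u"
  using assms
  by (auto simp: is_solution_def intro!: continuous_at_imp_continuous_on differentiable_imp_continuous_within)

lemma solution_diff_derivs:
  fixes u v :: "real \<Rightarrow> real"
  assumes u: "is_solution eps lam u" and v: "is_solution eps lam v" and eps: "eps > 0"
  shows "((\<lambda>t. u t - v t) has_real_derivative deriv u t - deriv v t) (at t)"
    and "((\<lambda>t. deriv u t - deriv v t) has_real_derivative
      ((u t)\<^sup>2 + u t * v t + (v t)\<^sup>2 - lam) / eps\<^sup>2 * (u t - v t)) (at t)"
proof -
  show "((\<lambda>t. u t - v t) has_real_derivative deriv u t - deriv v t) (at t)"
    by (intro derivative_intros solution_derivs[OF u eps] solution_derivs[OF v eps])
  have eq: "((u t)^3 - lam * u t + cos t) / eps\<^sup>2 - ((v t)^3 - lam * v t + cos t) / eps\<^sup>2 =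
      ((u t)\<^sup>2 + u t * v t + (v t)\<^sup>2 - lam) / eps\<^sup>2 * (u t - v t)"
    using eps by (simp add: field_simps power2_eq_square power3_eq_cube)
  show "((\<lambda>t. deriv u t - deriv v t) has_real_derivative
      ((u t)\<^sup>2 + u t * v t + (v t)\<^sup>2 - lam) / eps\<^sup>2 * (u t - v t)) (at t)"
    unfolding eq[symmetric]
    by (intro derivative_intros solution_derivs[OF u eps] solution_derivs[OF v eps])
qed

lemma solution_unique:
  assumes u: "is_solution eps lam u" and v: "is_solution eps lam v" and eps: "eps > 0"
    and "u a = v a" "deriv u a = deriv v a"
  shows "u = v"
proof
  fix t
  have "continuous_on UNIV (\<lambda>t. ((u t)\<^sup>2 + u t * v t + (v t)\<^sup>2 - lam) / eps\<^sup>2)"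
    using eps by (intro continuous_intros solution_continuous[OF u] solution_continuous[OF v]) auto
  from linear_ode_zero[OF solution_diff_derivs[OF u v eps] this, of a t] assms
  show "u t = v t" by simp
qed

lemma solution_reflect:
  assumes u: "is_solution eps lam u" and eps: "eps > 0"
  shows "is_solution eps lam (\<lambda>t. u (- t))" and "deriv (\<lambda>t. u (- t)) = (\<lambda>t. - deriv u (- t))"
proof -
  have D1: "((\<lambda>s. u (- s)) has_real_derivative - deriv u (- s)) (at s)" for s
    by (rule DERIV_mirror[THEN iffD1, OF solution_derivs(1)[OF u eps]])
  have D2: "((\<lambda>s. - deriv u (- s)) has_real_derivative
      ((u (- s))^3 - lam * u (- s) + cos s) / eps\<^sup>2) (at s)" for s
    using DERIV_minus[OF solution_derivs(2)[OF u eps, of "- s", unfolded DERIV_mirror]] by simp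
  show "is_solution eps lam (\<lambda>t. u (- t))" "deriv (\<lambda>t. u (- t)) = (\<lambda>t. - deriv u (- t))"
    by (rule is_solutionI[OF D1 D2 eps])+
qed

lemma solution_shift:
  assumes u: "is_solution eps lam u" and eps: "eps > 0"
  shows "is_solution eps lam (\<lambda>t. u (t + 2 * pi))"
proof (rule is_solutionI(1)[OF _ _ eps])
  fix t
  show "((\<lambda>t. u (t + 2 * pi)) has_real_derivative deriv u (t + 2 * pi)) (at t)"
    using solution_derivs(1)[OF u eps, of "t + 2 * pi"] by (simp add: DERIV_shift)
  show "((\<lambda>t. deriv u (t + 2 * pi)) has_real_derivative
      ((u (t + 2 * pi))^3 - lam * u (t + 2 * pi) + cos t) / eps\<^sup>2) (at t)"
    using solution_derivs(2)[OF u eps, of "t + 2 * pi"] by (simp add: DERIV_shift)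
qed

text \<open>The cubic is odd and \<open>cos (t + pi) = - cos t\<close>. This symmetry exchanges the
  negative and the positive outer solution, so one-sided results transfer to the other side.\<close>

lemma solution_antishift:
  assumes u: "is_solution eps lam u" and eps: "eps > 0"
  shows "is_solution eps lam (\<lambda>t. - u (t + pi))"
proof (rule is_solutionI(1)[OF _ _ eps])
  fix t
  show "((\<lambda>t. - u (t + pi)) has_real_derivative - deriv u (t + pi)) (at t)"
    using solution_derivs(1)[OF u eps, of "t + pi"]
    by (intro DERIV_minus) (simp add: DERIV_shift)
  have eq: "((- u (t + pi))^3 - lam * - u (t + pi) + cos t) / eps\<^sup>2 =
      - (((u (t + pi))^3 - lam * u (t + pi) + cos (t + pi)) / eps\<^sup>2)"
    using eps by (simp add: field_simps)
  show "((\<lambda>t. - deriv u (t + pi)) has_real_derivative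
      ((- u (t + pi))^3 - lam * - u (t + pi) + cos t) / eps\<^sup>2) (at t)"
    unfolding eq using solution_derivs(2)[OF u eps, of "t + pi"]
    by (intro DERIV_minus) (simp add: DERIV_shift)
qed

lemma solution_even:
  assumes u: "is_solution eps lam u" and eps: "eps > 0" and "deriv u 0 = 0"
  shows "u (- t) = u t" and "deriv u (- t) = - deriv u t"
proof -
  have eq: "(\<lambda>t. u (- t)) = u"
    by (rule solution_unique[OF solution_reflect(1)[OF u eps] u eps, of 0])
      (use solution_reflect(2)[OF u eps] assms in simp_all)
  then show "u (- t) = u t" by (rule fun_cong)
  have "deriv u t = - deriv u (- t)"
    using solution_reflect(2)[OF u eps] unfolding eq by (rule fun_cong)
  then show "deriv u (- t) = - deriv u t" by simp
qed

lemma periodic_2pi_deriv: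
  assumes u: "is_solution eps lam u" and eps: "eps > 0" and per: "periodic_2pi u"
  shows "deriv u (t + 2 * pi) = deriv u t"
proof -
  have "(\<lambda>t. u (t + 2 * pi)) = u" using per by (simp add: periodic_2pi_def)
  moreover have "((\<lambda>t. u (t + 2 * pi)) has_real_derivative deriv u (t + 2 * pi)) (at t)"
    using solution_derivs(1)[OF u eps, of "t + 2 * pi"] by (simp add: DERIV_shift)
  ultimately show ?thesis
    using DERIV_unique solution_derivs(1)[OF u eps] by metis
qed

section \<open>The outer solutions\<close>

lemma solution_third_deriv:
  assumes u: "is_solution eps lam u" and eps: "eps > 0"
  shows "((\<lambda>t. ((u t)^3 - lam * u t + cos t) / eps\<^sup>2) has_real_derivative
    ((3 * (u t)\<^sup>2 - lam) * deriv u t - sin t) / eps\<^sup>2) (at t)"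
  by (rule derivative_eq_intros solution_derivs(1)[OF u eps] refl)+
    (use eps in \<open>simp_all add: field_simps power2_eq_square\<close>)

text \<open>Where \<open>v < u < 0\<close>, both \<open>v\<^sup>2\<close> and \<open>u * v\<close>
  are at least \<open>u\<^sup>2\<close>, so the coefficient in the equation for \<open>v - u\<close>
  is at least \<open>3 * u\<^sup>2 - lam > 0\<close>: the difference is concave where it is
  negative.\<close>

lemma bounded_solution_below:
  assumes u: "bounded_solution eps lam u" and v: "bounded_solution eps lam v" and eps: "eps > 0"
    and neg: "\<And>t. u t < 0 \<and> 3 * (u t)\<^sup>2 - lam > 0"
  shows "u t \<le> v t"
proof -
  have u': "is_solution eps lam u" "bounded (range u)"
    and v': "is_solution eps lam v" "bounded (range v)"
    using u v by (auto simp: bounded_solution_def)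
  have "v t - u t \<ge> 0"
  proof (rule bounded_concave_where_negative[OF solution_diff_derivs[OF v'(1) u'(1) eps]])
    fix t assume less: "v t - u t < 0"
    have "(u t)\<^sup>2 \<le> v t * u t"
      unfolding power2_eq_square by (rule mult_right_mono_neg) (use less neg[of t] in auto)
    moreover have "v t * u t \<le> (v t)\<^sup>2"
      unfolding power2_eq_square by (rule mult_left_mono_neg) (use less neg[of t] in auto)
    ultimately have "(v t)\<^sup>2 + v t * u t + (u t)\<^sup>2 - lam > 0"
      using neg[of t] by simp
    then show "((v t)\<^sup>2 + v t * u t + (u t)\<^sup>2 - lam) / eps\<^sup>2 * (v t - u t) < 0"
      using less eps by (intro mult_pos_neg) simp_all
  next
    show "bounded (range (\<lambda>t. v t - u t))"
      using bounded_minus_comp[OF v'(2) u'(2)] by simp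
  qed
  then show ?thesis by simp
qed

text \<open>A contact point would be a minimum of \<open>v - u\<close>, so values and slopes would
  agree there and the solutions would coincide.\<close>

lemma bounded_solution_below_strict:
  assumes u: "bounded_solution eps lam u" and v: "bounded_solution eps lam v" and eps: "eps > 0"
    and neg: "\<And>t. u t < 0 \<and> 3 * (u t)\<^sup>2 - lam > 0"
    and "v \<noteq> u"
  shows "u t < v t"
proof (rule ccontr)
  assume "\<not> u t < v t"
  with bounded_solution_below[OF u v eps neg] have eq: "v t = u t"
    by (meson antisym not_le)
  have u': "is_solution eps lam u" and v': "is_solution eps lam v"
    using u v by (auto simp: bounded_solution_def)
  have "deriv v t - deriv u t = 0"
    using second_deriv_at_local_min(1)[OF solution_diff_derivs[OF v' u' eps], of 1 t]
      bounded_solution_below[OF u v eps neg] eq by simp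
  with solution_unique[OF v' u' eps eq] \<open>v \<noteq> u\<close> show False by simp
qed

section \<open>The roots of the cubic and its increasing negative branch\<close>

lemma cubic_diff_sign:
  fixes x y lam c :: real
  assumes "x < 0" "3 * x\<^sup>2 > lam" "y < 0" "3 * y\<^sup>2 > lam" "x < y"
  shows "x^3 - lam * x + c < y^3 - lam * y + c"
proof -
  have "y\<^sup>2 \<le> x * y"
    unfolding power2_eq_square by (rule mult_right_mono_neg) (use assms in auto)
  moreover have "x * y \<le> x\<^sup>2"
    unfolding power2_eq_square by (rule mult_left_mono_neg) (use assms in auto)
  \<comment> \<open>The sum \<open>x\<^sup>2 + x * y + y\<^sup>2\<close> is at least
    \<open>3 * y\<^sup>2\<close>, hence exceeds \<open>lam\<close>.\<close>
  ultimately have "(y - x) * (x\<^sup>2 + x * y + y\<^sup>2 - lam) > 0"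
    using assms by simp
  then show ?thesis by (simp add: algebra_simps power2_eq_square power3_eq_cube)
qed

text \<open>The critical points are \<open>- s\<close> and \<open>s\<close> with
  \<open>s = sqrt (lam / 3)\<close>, and the critical values are \<open>2 * s ^ 3 + c\<close> and
  \<open>- 2 * s ^ 3 + c\<close>. The bound on \<open>lam\<close> says precisely that
  \<open>s ^ 3 > 1 / 2\<close>, so these have opposite signs whenever
  \<open>\<bar>c\<bar> \<le> 1\<close>.\<close>

lemma cubic_three_roots:
  fixes lam c :: real
  assumes lam: "lam > 3 / 2 powr (2/3)" and c: "\<bar>c\<bar> \<le> 1"
  obtains x y z where "x < y" "y < z" "{u. u^3 - lam * u + c = 0} = {x, y, z}"
    "x < 0" "3 * x\<^sup>2 > lam"
proof -
  define s where "s = sqrt (lam / 3)"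
  have "0 < 3 / (2 powr (2/3) :: real)" by simp
  then have pos: "lam > 0" using lam by (rule less_trans)
  have s: "s > 0" "s\<^sup>2 = lam / 3" using pos by (auto simp: s_def)
  have "(1 / 2 powr (2/3)) ^ 3 < (lam / 3) ^ 3"
    by (rule power_strict_mono) (use lam in \<open>auto simp: field_simps\<close>)
  moreover have "(2 powr (2/3)) ^ 3 = (4::real)"
    by (simp add: powr_power)
  ultimately have "1 / 4 < (s ^ 3)\<^sup>2"
    unfolding s(2)[symmetric] by (simp add: power_divide power_mult[symmetric])
  then have "(1 / 2)\<^sup>2 < (s ^ 3)\<^sup>2"
    by (simp add: power_divide)
  then have s3: "s ^ 3 > 1 / 2"
    by (rule power2_less_imp_less) (use s in simp)
  define p where "p u = u^3 - lam * u + c" for u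
  have cont: "continuous_on A p" for A
    unfolding p_def by (intro continuous_intros)
  have lam_s: "lam = 3 * s\<^sup>2" using s by simp
  have p_s: "p (- s) > 0" "p s < 0"
    using s3 c unfolding p_def lam_s by (auto simp: power2_eq_square power3_eq_cube)
  \<comment> \<open>Large enough that \<open>M * (M\<^sup>2 - lam) > 1 \<ge> \<bar>c\<bar>\<close>,
    so that \<open>- M\<close> and \<open>M\<close> bracket the outer roots.\<close>
  define M where "M = lam + 1 + s"
  have M: "M > s" "M \<ge> 1" using pos s by (auto simp: M_def)
  have "M * M \<ge> M * 1" using M by (intro mult_left_mono) auto
  then have "M\<^sup>2 - lam > 1"
    using s by (simp add: M_def power2_eq_square)
  moreover from this have "M\<^sup>2 - lam \<le> M * (M\<^sup>2 - lam)"
    using mult_right_mono[of 1 M "M\<^sup>2 - lam"] M by simp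
  ultimately have "M * (M\<^sup>2 - lam) > 1" by (rule less_le_trans)
  then have p_M: "p (- M) < 0" "p M > 0"
    using c unfolding p_def by (auto simp: power2_eq_square power3_eq_cube algebra_simps)
  obtain x where x: "- M \<le> x" "x \<le> - s" "p x = 0"
    using IVT'[of p "- M" 0 "- s"] cont p_M p_s M by auto
  obtain y where y: "- s \<le> y" "y \<le> s" "p y = 0"
    using IVT2'[of p s 0 "- s"] cont p_s s by auto
  obtain z where z: "s \<le> z" "z \<le> M" "p z = 0"
    using IVT'[of p s 0 M] cont p_M p_s M by auto
  have ne: "x \<noteq> - s" "y \<noteq> - s" "y \<noteq> s" "z \<noteq> s"
    using x y z p_s by auto
  then have order: "x < y" "y < z" "x < z" "x < - s" using x y z s by auto
  have factor: "p u - p v = (u - v) * (u\<^sup>2 + u * v + v\<^sup>2 - lam)" for u v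
    by (simp add: p_def algebra_simps power2_eq_square power3_eq_cube)
  have yx: "y\<^sup>2 + y * x + x\<^sup>2 - lam = 0" and zx: "z\<^sup>2 + z * x + x\<^sup>2 - lam = 0"
    using factor[of y x] factor[of z x] x y z order by auto
  \<comment> \<open>The quadratic cofactor of \<open>u - x\<close> vanishes at \<open>y\<close> and
    \<open>z\<close>. This gives \<open>x + y + z = 0\<close>, whence the cofactor is
    \<open>(u - y) * (u - z)\<close> and there is no further root.\<close>
  have "(y - z) * (x + y + z) = 0"
    using yx zx by (simp add: algebra_simps power2_eq_square)
  then have sum: "z = - x - y" using order by simp
  have "{u. u^3 - lam * u + c = 0} = {x, y, z}"
  proof (intro set_eqI iffI)
    fix u assume "u \<in> {u. u^3 - lam * u + c = 0}"
    then have "p u = 0" by (simp add: p_def)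
    then have "u = x \<or> u\<^sup>2 + u * x + x\<^sup>2 - lam = 0"
      using factor[of u x] x by auto
    moreover have "(u - y) * (u - z) = 0" if "u\<^sup>2 + u * x + x\<^sup>2 - lam = 0"
      using that yx unfolding sum by (simp add: algebra_simps power2_eq_square)
    ultimately show "u \<in> {x, y, z}" by auto
  qed (use x y z in \<open>auto simp: p_def\<close>)
  moreover have "s\<^sup>2 < x\<^sup>2"
    using power_strict_mono[of s "- x" 2] order s by simp
  ultimately show ?thesis
    using that[of x y z] order s by simp
qed

lemma U_lower_root:
  assumes lam: "lam > 3 / 2 powr (2/3)"
  shows "(U_lower lam t)^3 - lam * U_lower lam t + cos t = 0"
    and "U_lower lam t < 0" and "3 * (U_lower lam t)\<^sup>2 > lam"
proof -
  obtain x y z where xyz: "x < y" "y < z" "{u. u^3 - lam * u + cos t = 0} = {x, y, z}"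
    "x < 0" "3 * x\<^sup>2 > lam"
    using cubic_three_roots[OF lam, of "cos t"] by auto
  have "U_lower lam t = x"
    unfolding U_lower_def
  proof (rule the_equality)
    fix x' assume "\<exists>y z. x' < y \<and> y < z \<and> {u. u^3 - lam * u + cos t = 0} = {x', y, z}"
    then obtain y' z' where "x' < y'" "y' < z'" "{x, y, z} = {x', y', z'}"
      using xyz by auto
    \<comment> \<open>The set of roots determines its least element, so the definite description has
      a single witness.\<close>
    then have "Min {x, y, z} = x'" by (simp add: min_def)
    moreover have "Min {x, y, z} = x" using xyz by (simp add: min_def)
    ultimately show "x' = x" by simp
  qed (use xyz in blast)
  with xyz show "(U_lower lam t)^3 - lam * U_lower lam t + cos t = 0"
    "U_lower lam t < 0" "3 * (U_lower lam t)\<^sup>2 > lam"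
    by auto
qed

section \<open>Monotonicity of the outer solutions and the strict root bounds\<close>

lemma nonneg_boundary_slope:
  fixes w w' w'' c :: "real \<Rightarrow> real"
  assumes w: "\<And>t. (w has_real_derivative w' t) (at t)"
    and w': "\<And>t. (w' has_real_derivative w'' t) (at t)"
    and c: "continuous_on {0..b} c"
    and le: "\<And>t. 0 \<le> t \<Longrightarrow> t \<le> b \<Longrightarrow> w'' t \<le> c t * w t"
    and nonneg: "\<And>t. 0 \<le> t \<Longrightarrow> t \<le> b \<Longrightarrow> w t \<ge> 0"
    and zero: "w 0 = 0" and pos: "w t > 0" "0 \<le> t" "t \<le> b"
  shows "w' 0 > 0"
proof (rule ccontr)
  assume "\<not> w' 0 > 0"
  have "compact (c ` {0..b})"
    by (rule compact_continuous_image[OF c]) auto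
  then obtain C where "\<forall>x\<in>c ` {0..b}. norm x \<le> C"
    using compact_imp_bounded bounded_iff by blast
  then have C: "\<And>s. s \<in> {0..b} \<Longrightarrow> \<bar>c s\<bar> \<le> C" by simp
  have "C \<ge> 0" using C[of 0] pos by simp
  \<comment> \<open>Hopf's lemma in one dimension: \<open>w 0 = 0\<close> with
    \<open>w' 0 \<le> 0\<close> is admissible initial data for the Gronwall estimate with
    \<open>k = sqrt C\<close>. Nonnegativity of \<open>w\<close> allows \<open>c\<close> to be
    replaced by its bound \<open>C\<close>.\<close>
  have "w t \<le> 0"
  proof (rule second_order_gronwall[OF w w'])
    fix s assume s: "0 \<le> s" "s \<le> b"
    have "c s * w s \<le> C * w s"
      by (rule mult_right_mono) (use C[of s] s nonneg in auto)
    with le[OF s] show "w'' s \<le> (sqrt C)\<^sup>2 * w s"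
      using \<open>C \<ge> 0\<close> by simp
  qed (use pos zero \<open>\<not> w' 0 > 0\<close> in auto)
  with pos show False by simp
qed

lemma outer_solution_increasing:
  assumes u: "is_solution eps lam u" and eps: "eps > 0"
    and reg: "\<And>t. 3 * (u t)\<^sup>2 - lam > 0"
    and ends: "deriv u 0 = 0" "deriv u pi = 0" and t: "0 < t" "t < pi"
  shows "deriv u t > 0"
proof (rule ccontr)
  assume "\<not> deriv u t > 0"
  note w = solution_derivs(2)[OF u eps]
  note w' = solution_third_deriv[OF u eps]
  have cont: "continuous_on {0..pi} (deriv u)"
    by (meson w DERIV_isCont continuous_at_imp_continuous_on)
  obtain m where m: "m \<in> {0..pi}" "\<And>s. s \<in> {0..pi} \<Longrightarrow> deriv u m \<le> deriv u s"
    using continuous_attains_inf[OF _ _ cont] by auto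
  \<comment> \<open>A nonpositive minimum can be taken in the interior: if it sits at an endpoint
    its value is 0, and then \<open>t\<close> attains it as well. There the equation for
    \<open>u'\<close> makes its second derivative negative, because
    \<open>sin x > 0\<close>.\<close>
  have "\<exists>x. 0 < x \<and> x < pi \<and> deriv u x \<le> 0 \<and> (\<forall>s\<in>{0..pi}. deriv u x \<le> deriv u s)"
  proof (cases "m = 0 \<or> m = pi")
    case True
    then have "deriv u m = 0" using ends by auto
    then have "deriv u t = 0" using m(2)[of t] t \<open>\<not> deriv u t > 0\<close> by auto
    then show ?thesis using m t \<open>deriv u m = 0\<close> by (intro exI[of _ t]) auto
  next
    case False
    moreover have "deriv u m \<le> 0" using m(2)[of t] t \<open>\<not> deriv u t > 0\<close> by simp
    ultimately show ?thesis using m by (intro exI[of _ m]) auto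
  qed
  then obtain x where x: "0 < x" "x < pi" "deriv u x \<le> 0"
    and min: "\<And>s. s \<in> {0..pi} \<Longrightarrow> deriv u x \<le> deriv u s" by blast
  have "((3 * (u x)\<^sup>2 - lam) * deriv u x - sin x) / eps\<^sup>2 \<ge> 0"
    by (rule second_deriv_at_local_min(2)[OF w w', of "min x (pi - x)"]) (use x in \<open>auto intro!: min\<close>)
  then have "(3 * (u x)\<^sup>2 - lam) * deriv u x - sin x \<ge> 0"
    using eps by (simp add: zero_le_divide_iff)
  moreover have "(3 * (u x)\<^sup>2 - lam) * deriv u x \<le> 0"
    using reg[of x] x by (simp add: mult_nonneg_nonpos)
  ultimately show False using sin_gt_zero[of x] x by simp
qed

lemma outer_solution_bounds:
  assumes u: "is_solution eps lam u" and eps: "eps > 0" and lam: "lam > 3 / 2 powr (2/3)"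
    and neg: "\<And>t. u t < 0 \<and> 3 * (u t)\<^sup>2 - lam > 0"
    and ends: "deriv u 0 = 0" "deriv u pi = 0" and t: "0 \<le> t" "t \<le> pi"
  shows "U_lower lam 0 < u t" and "u t < U_lower lam pi"
proof -
  have inc: "deriv u s > 0" if "0 < s" "s < pi" for s
    using outer_solution_increasing[OF u eps _ ends] neg that by blast
  have ge: "deriv u s \<ge> 0" if "0 \<le> s" "s \<le> pi" for s
    using inc[of s] ends that by (cases "s = 0 \<or> s = pi") auto
  have mono: "u r \<le> u s" if "0 \<le> r" "r \<le> s" "s \<le> pi" for r s
    using DERIV_nonneg_imp_nondecreasing[OF that(2), of u] solution_derivs(1)[OF u eps] ge that
    by (meson order_trans)
  define F where "F s = ((u s)^3 - lam * u s + cos s) / eps\<^sup>2" for s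
  have w: "(deriv u has_real_derivative F s) (at s)" for s
    using solution_derivs(2)[OF u eps] by (simp add: F_def)
  define G where "G s = ((3 * (u s)\<^sup>2 - lam) * deriv u s - sin s) / eps\<^sup>2" for s
  have F: "(F has_real_derivative G s) (at s)" for s
    using solution_third_deriv[OF u eps] by (simp add: F_def[abs_def] G_def)
  have cont: "continuous_on A (\<lambda>s. (3 * (u s)\<^sup>2 - lam) / eps\<^sup>2)" for A
    using eps by (intro continuous_intros solution_continuous[OF u]) auto
  \<comment> \<open>Dropping \<open>- sin s \<le> 0\<close> turns the equation for \<open>u'\<close>
    into the differential inequality required by the boundary slope lemma.\<close>
  have G_le: "G s \<le> (3 * (u s)\<^sup>2 - lam) / eps\<^sup>2 * deriv u s" if "0 \<le> s" "s \<le> pi" for s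
    using sin_ge_zero[of s] that eps by (simp add: G_def divide_right_mono)
  have pos: "deriv u (pi/2) > 0" using inc by simp
  \<comment> \<open>\<open>F\<close> is \<open>u''\<close>. Its positivity at 0 makes the cubic
    positive at \<open>u 0\<close>, and since the cubic increases on this branch, \<open>u 0\<close>
    lies strictly above the root.\<close>
  have "F 0 > 0"
    by (rule nonneg_boundary_slope[OF w F cont G_le ge ends(1) pos]) auto
  then have F0: "(u 0)^3 - lam * u 0 + cos 0 > 0"
    using eps by (simp add: F_def zero_less_divide_iff)
  have "U_lower lam 0 < u 0"
  proof (rule ccontr)
    assume "\<not> ?thesis"
    then show False
      using cubic_diff_sign[of "u 0" lam "U_lower lam 0" "cos 0"] neg[of 0]
        U_lower_root[OF lam, of 0] F0
      by (cases "u 0 = U_lower lam 0") auto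
  qed
  with mono[of 0 t] t show "U_lower lam 0 < u t" by simp
  have shift: "((\<lambda>s. f (pi - s)) has_real_derivative - f' (pi - s)) (at s)"
    if "\<And>s. (f has_real_derivative f' s) (at s)" for f f' :: "real \<Rightarrow> real" and s
    by (rule DERIV_cong[OF DERIV_chain2[OF that]]) (auto intro!: derivative_eq_intros)
  have D2: "((\<lambda>s. - F (pi - s)) has_real_derivative G (pi - s)) (at s)" for s
    using DERIV_minus[OF shift[OF F]] by simp
  have cont': "continuous_on {0..pi} (\<lambda>s. (3 * (u (pi - s))\<^sup>2 - lam) / eps\<^sup>2)"
    by (rule continuous_on_compose2[OF cont[of UNIV]]) (auto intro!: continuous_intros)
  \<comment> \<open>The same argument run backwards from \<open>pi\<close>, applied to
    \<open>deriv u (pi - s)\<close>, whose slope at \<open>s = 0\<close> is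
    \<open>- F pi\<close>.\<close>
  have "- F (pi - 0) > 0"
    by (rule nonneg_boundary_slope[OF shift[OF w] D2 cont', of "pi/2"])
      (use G_le ge ends pos in auto)
  then have "((u pi)^3 - lam * u pi + cos pi) / eps\<^sup>2 < 0"
    by (simp add: F_def)
  then have Fpi: "(u pi)^3 - lam * u pi + cos pi < 0"
    using eps by (simp add: divide_less_0_iff)
  have "u pi < U_lower lam pi"
  proof (rule ccontr)
    assume "\<not> ?thesis"
    then show False
      using cubic_diff_sign[of "U_lower lam pi" lam "u pi" "cos pi"] neg[of pi]
        U_lower_root[OF lam, of pi] Fpi
      by (cases "u pi = U_lower lam pi") auto
  qed
  with mono[of t pi] t show "u t < U_lower lam pi" by simp
qed

section \<open>A monotone iteration for the boundary value problem\<close>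

text \<open>The Green operator of \<open>u'' = k\<^sup>2 u - h\<close>, \<open>u'(0) = 0\<close>, \<open>u(b) = 0\<close>.\<close>

definition green :: "real \<Rightarrow> real \<Rightarrow> (real \<Rightarrow> real) \<Rightarrow> real \<Rightarrow> real" where
  "green k b h t =
    (sinh (k * (b - t)) * integral {0..t} (\<lambda>s. cosh (k * s) * h s) +
     cosh (k * t) * integral {t..b} (\<lambda>s. sinh (k * (b - s)) * h s)) / (k * cosh (k * b))"

definition green' :: "real \<Rightarrow> real \<Rightarrow> (real \<Rightarrow> real) \<Rightarrow> real \<Rightarrow> real" where
  "green' k b h t =
    (- cosh (k * (b - t)) * integral {0..t} (\<lambda>s. cosh (k * s) * h s) +
     sinh (k * t) * integral {t..b} (\<lambda>s. sinh (k * (b - s)) * h s)) / cosh (k * b)"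

lemma green_derivs:
  assumes h: "continuous_on {0..b} h" and k: "k > 0" and t: "t \<in> {0..b}"
  shows "(green k b h has_real_derivative green' k b h t) (at t within {0..b})"
    and "(green' k b h has_real_derivative k\<^sup>2 * green k b h t - h t) (at t within {0..b})"
proof -
  let ?A = "\<lambda>t. integral {0..t} (\<lambda>s. cosh (k * s) * h s)"
  let ?B = "\<lambda>t. integral {t..b} (\<lambda>s. sinh (k * (b - s)) * h s)"
  have A: "(?A has_real_derivative cosh (k * t) * h t) (at t within {0..b})"
    by (rule integral_has_real_derivative[OF _ t]) (intro continuous_intros h)
  have B: "(?B has_real_derivative - (sinh (k * (b - t)) * h t)) (at t within {0..b})"
    by (rule integral_has_real_derivative'[OF _ t]) (intro continuous_intros h)
  \<comment> \<open>The boundary terms of the two integrals cancel in the first derivative. In the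
    second they combine, by this addition formula, into \<open>- cosh (k * b) * h t\<close>.\<close>
  have cosh_b: "cosh (k * b) = cosh (k * (b - t)) * cosh (k * t) + sinh (k * (b - t)) * sinh (k * t)"
    using cosh_add[of "k * (b - t)" "k * t"] by (simp add: algebra_simps)
  have "((\<lambda>t. sinh (k * (b - t)) * ?A t + cosh (k * t) * ?B t) has_real_derivative
      k * (- cosh (k * (b - t)) * ?A t + sinh (k * t) * ?B t)) (at t within {0..b})"
    by (rule derivative_eq_intros A B refl)+ (simp add: algebra_simps)
  from DERIV_cdivide[OF this, of "k * cosh (k * b)"]
  show "(green k b h has_real_derivative green' k b h t) (at t within {0..b})"
    unfolding green_def[abs_def] green'_def using k by simp
  have "((\<lambda>t. - cosh (k * (b - t)) * ?A t + sinh (k * t) * ?B t) has_real_derivative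
      k * sinh (k * (b - t)) * ?A t + k * cosh (k * t) * ?B t - cosh (k * b) * h t)
      (at t within {0..b})"
    unfolding cosh_b
    by (rule derivative_eq_intros A B refl)+ (simp add: algebra_simps)
  from DERIV_cdivide[OF this, of "cosh (k * b)"]
  have "(green' k b h has_real_derivative
      (k * sinh (k * (b - t)) * ?A t + k * cosh (k * t) * ?B t - cosh (k * b) * h t) / cosh (k * b))
      (at t within {0..b})"
    unfolding green'_def[abs_def] .
  moreover have "(k * sinh (k * (b - t)) * ?A t + k * cosh (k * t) * ?B t - cosh (k * b) * h t) /
      cosh (k * b) = k\<^sup>2 * green k b h t - h t"
  proof -
    have eq: "k\<^sup>2 * (x / (k * y)) = k * x / y" for x y
      using k by (simp add: power2_eq_square)
    show ?thesis
      unfolding green_def eq by (simp add: diff_divide_distrib distrib_left mult.assoc)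
  qed
  ultimately show "(green' k b h has_real_derivative k\<^sup>2 * green k b h t - h t) (at t within {0..b})"
    by simp
qed

lemma green_mono:
  assumes cont: "continuous_on {0..b} g" "continuous_on {0..b} h" and k: "k > 0"
    and le: "\<And>s. s \<in> {0..b} \<Longrightarrow> g s \<le> h s" and t: "t \<in> {0..b}"
  shows "green k b g t \<le> green k b h t"
proof -
  have "integral {0..t} (\<lambda>s. cosh (k * s) * g s) \<le> integral {0..t} (\<lambda>s. cosh (k * s) * h s)"
    using le t cont
    by (intro integral_le integrable_continuous_real continuous_intros mult_left_mono)
      (auto elim: continuous_on_subset)
  moreover have "integral {t..b} (\<lambda>s. sinh (k * (b - s)) * g s)
      \<le> integral {t..b} (\<lambda>s. sinh (k * (b - s)) * h s)"
    using le t k cont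
    by (intro integral_le integrable_continuous_real continuous_intros mult_left_mono)
      (auto elim: continuous_on_subset)
  ultimately show ?thesis
    unfolding green_def using k t
    by (intro divide_right_mono add_mono mult_left_mono) auto
qed

text \<open>This provides the barriers of the iteration: the value is 0 for \<open>c = 0\<close> and
  at least \<open>- M\<close> for \<open>c = - (k\<^sup>2 * M)\<close>.\<close>

lemma green_const:
  assumes k: "k > 0" and t: "t \<in> {0..b}"
  shows "green k b (\<lambda>_. c) t = c / k\<^sup>2 * (1 - cosh (k * t) / cosh (k * b))"
proof -
  have A: "integral {0..t} (\<lambda>s. cosh (k * s) * c) = c * sinh (k * t) / k"
  proof (rule integral_unique)
    have "((\<lambda>s. c * sinh (k * s) / k) has_real_derivative cosh (k * s) * c) (at s within {0..t})" for s
      by (rule derivative_eq_intros refl)+ (use k in simp_all)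
    then have "((\<lambda>s. cosh (k * s) * c) has_integral c * sinh (k * t) / k - c * sinh (k * 0) / k) {0..t}"
      using t by (intro fundamental_theorem_of_calculus)
        (auto simp flip: has_real_derivative_iff_has_vector_derivative)
    then show "((\<lambda>s. cosh (k * s) * c) has_integral c * sinh (k * t) / k) {0..t}" by simp
  qed
  have B: "integral {t..b} (\<lambda>s. sinh (k * (b - s)) * c) = c * (cosh (k * (b - t)) - 1) / k"
  proof (rule integral_unique)
    have "((\<lambda>s. c * cosh (k * (b - s)) / k) has_real_derivative - (sinh (k * (b - s)) * c))
        (at s within {t..b})" for s
      by (rule derivative_eq_intros refl)+ (use k in simp_all)
    from DERIV_minus[OF this] have "((\<lambda>s. - (c * cosh (k * (b - s)) / k)) has_real_derivative sinh (k * (b - s)) * c)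
        (at s within {t..b})" for s
      by simp
    then have "((\<lambda>s. sinh (k * (b - s)) * c) has_integral
        - (c * cosh (k * (b - b)) / k) - - (c * cosh (k * (b - t)) / k)) {t..b}"
      using t by (intro fundamental_theorem_of_calculus)
        (auto simp flip: has_real_derivative_iff_has_vector_derivative)
    moreover have "- (c * cosh (k * (b - b)) / k) - - (c * cosh (k * (b - t)) / k) =
        c * (cosh (k * (b - t)) - 1) / k"
      by (simp add: right_diff_distrib diff_divide_distrib)
    ultimately show "((\<lambda>s. sinh (k * (b - s)) * c) has_integral c * (cosh (k * (b - t)) - 1) / k) {t..b}"
      by simp
  qed
  have cosh_b: "cosh (k * b) = cosh (k * (b - t)) * cosh (k * t) + sinh (k * (b - t)) * sinh (k * t)"
    using cosh_add[of "k * (b - t)" "k * t"] by (simp add: algebra_simps)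
  have "sinh (k * (b - t)) * (c * sinh (k * t) / k) +
      cosh (k * t) * (c * (cosh (k * (b - t)) - 1) / k) = c / k * (cosh (k * b) - cosh (k * t))"
    unfolding cosh_b
    by (simp add: distrib_left right_diff_distrib add_divide_distrib diff_divide_distrib mult_ac)
  then have "green k b (\<lambda>_. c) t = c / k * (cosh (k * b) - cosh (k * t)) / (k * cosh (k * b))"
    unfolding green_def A B by simp
  also have "\<dots> = c / k\<^sup>2 * ((cosh (k * b) - cosh (k * t)) / cosh (k * b))"
    by (simp add: power2_eq_square)
  finally show ?thesis
    by (simp add: diff_divide_distrib)
qed

text \<open>The limit \<open>g\<close> is known only pointwise, so its weighted integrability is a
  conclusion; it comes from dominated convergence along with the limit.\<close>

lemma weighted_integral_limit:
  fixes q g :: "real \<Rightarrow> real" and h :: "nat \<Rightarrow> real \<Rightarrow> real"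
  assumes q: "continuous_on {c..d} q" and h: "\<And>n. continuous_on {c..d} (h n)"
    and bound: "\<And>n s. s \<in> {c..d} \<Longrightarrow> \<bar>h n s\<bar> \<le> C"
    and lim: "\<And>s. s \<in> {c..d} \<Longrightarrow> (\<lambda>n. h n s) \<longlonglongrightarrow> g s"
  shows "(\<lambda>s. q s * g s) integrable_on {c..d}"
    and "(\<lambda>n. integral {c..d} (\<lambda>s. q s * h n s)) \<longlonglongrightarrow> integral {c..d} (\<lambda>s. q s * g s)"
proof -
  have int: "(\<lambda>s. q s * h n s) integrable_on {c..d}" for n
    by (intro integrable_continuous_real continuous_intros q h)
  have dom: "(\<lambda>s. \<bar>q s\<bar> * C) integrable_on {c..d}"
    by (intro integrable_continuous_real continuous_intros q)
  have le: "norm (q s * h n s) \<le> \<bar>q s\<bar> * C" if "s \<in> {c..d}" for n s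
    using bound[OF that] by (simp add: abs_mult mult_left_mono)
  have conv: "(\<lambda>n. q s * h n s) \<longlonglongrightarrow> q s * g s" if "s \<in> {c..d}" for s
    by (intro tendsto_intros lim that)
  show "(\<lambda>s. q s * g s) integrable_on {c..d}"
    "(\<lambda>n. integral {c..d} (\<lambda>s. q s * h n s)) \<longlonglongrightarrow> integral {c..d} (\<lambda>s. q s * g s)"
    by (rule dominated_convergence[where f = "\<lambda>n s. q s * h n s", OF int dom le conv]; assumption)+
qed

text \<open>The integrals depend continuously on their endpoint even for merely integrable
  integrands. This later restores the continuity lost in a pointwise limit.\<close>

lemma green_limit:
  assumes h: "\<And>n. continuous_on {0..b} (h n)"
    and bound: "\<And>n s. s \<in> {0..b} \<Longrightarrow> \<bar>h n s\<bar> \<le> C"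
    and lim: "\<And>s. s \<in> {0..b} \<Longrightarrow> (\<lambda>n. h n s) \<longlonglongrightarrow> g s" and k: "k > 0"
  shows "continuous_on {0..b} (green k b g)"
    and "t \<in> {0..b} \<Longrightarrow> (\<lambda>n. green k b (h n) t) \<longlonglongrightarrow> green k b g t"
proof -
  have "continuous_on {0..b} (\<lambda>t. integral {0..t} (\<lambda>s. cosh (k * s) * g s))"
    by (intro indefinite_integral_continuous_1 weighted_integral_limit(1)[OF _ h bound lim])
      (auto intro!: continuous_intros)
  moreover have "continuous_on {0..b} (\<lambda>t. integral {t..b} (\<lambda>s. sinh (k * (b - s)) * g s))"
    by (intro indefinite_integral_continuous_1' weighted_integral_limit(1)[OF _ h bound lim])
      (auto intro!: continuous_intros)
  ultimately show "continuous_on {0..b} (green k b g)"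
    unfolding green_def[abs_def] using k by (intro continuous_intros) auto
next
  assume t: "t \<in> {0..b}"
  have h': "continuous_on {0..t} (h n)" "continuous_on {t..b} (h n)" for n
    using t by (auto intro: continuous_on_subset[OF h])
  show "(\<lambda>n. green k b (h n) t) \<longlonglongrightarrow> green k b g t"
    unfolding green_def using k t
    by (intro tendsto_intros weighted_integral_limit(2)[where C = C, OF _ h'(1)]
        weighted_integral_limit(2)[where C = C, OF _ h'(2)] continuous_intros bound lim) auto
qed

text \<open>Starting at the upper solution 0, the iterates decrease, since \<open>h\<close> is
  monotone in its first argument and the Green operator preserves order, and they stay above
  \<open>- M\<close>. Their pointwise limit is a fixed point.\<close>

lemma monotone_iteration:
  fixes h :: "real \<Rightarrow> real \<Rightarrow> real"
  assumes k: "k > 0" and b: "b \<ge> 0" and M: "M \<ge> 0"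
    and cont: "continuous_on UNIV (\<lambda>p. h (fst p) (snd p))"
    and mono: "\<And>x y s. - M \<le> x \<Longrightarrow> x \<le> y \<Longrightarrow> y \<le> 0 \<Longrightarrow> s \<in> {0..b} \<Longrightarrow> h x s \<le> h y s"
    and upper: "\<And>s. s \<in> {0..b} \<Longrightarrow> h 0 s \<le> 0"
    and lower: "\<And>s. s \<in> {0..b} \<Longrightarrow> - (k\<^sup>2 * M) \<le> h (- M) s"
  obtains u where "continuous_on {0..b} u" "\<And>t. t \<in> {0..b} \<Longrightarrow> - M \<le> u t \<and> u t \<le> 0"
    "\<And>t. t \<in> {0..b} \<Longrightarrow> u t = green k b (\<lambda>s. h (u s) s) t"
proof -
  have cont_h: "continuous_on A (\<lambda>s. h (v s) s)" if "continuous_on A v" for v and A :: "real set"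
  proof -
    have "continuous_on A (\<lambda>s. (v s, s))"
      by (intro continuous_intros that)
    from continuous_on_compose2[OF cont this] show ?thesis by simp
  qed
  define u where "u = rec_nat (\<lambda>_. 0) (\<lambda>_ v. green k b (\<lambda>s. h (v s) s))"
  have u0: "u 0 = (\<lambda>_. 0)" and uS: "u (Suc n) = green k b (\<lambda>s. h (u n s) s)" for n
    by (simp_all add: u_def)
  have cont_u: "continuous_on {0..b} (u n)" for n
  proof (induction n)
    case (Suc n)
    show ?case
      unfolding uS
      using green_derivs(1)[OF cont_h[OF Suc] k] by (rule DERIV_continuous_on)
  qed (simp add: u0)
  have low: "- M \<le> green k b (\<lambda>s. h (v s) s) t"
    if t: "t \<in> {0..b}" and v: "continuous_on {0..b} v" "\<And>s. s \<in> {0..b} \<Longrightarrow> - M \<le> v s \<and> v s \<le> 0"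
    for v t
  proof -
    have "M * (1 - cosh (k * t) / cosh (k * b)) \<le> M * 1"
      using M by (intro mult_left_mono) auto
    then have "- M \<le> green k b (\<lambda>_. - (k\<^sup>2 * M)) t"
      unfolding green_const[OF k t] using k by simp
    also have "\<dots> \<le> green k b (\<lambda>s. h (v s) s) t"
    proof (rule green_mono[OF _ cont_h[OF v(1)] k _ t])
      fix s assume s: "s \<in> {0..b}"
      have "h (- M) s \<le> h (v s) s"
        using v(2)[OF s] by (intro mono s) auto
      with lower[OF s] show "- (k\<^sup>2 * M) \<le> h (v s) s" by simp
    qed (rule continuous_on_const)
    finally show ?thesis .
  qed
  \<comment> \<open>Bounds and monotonicity are proved together, because \<open>mono\<close>
    compares only arguments between \<open>- M\<close> and 0.\<close>
  have range: "- M \<le> u (Suc n) t \<and> u (Suc n) t \<le> u n t \<and> u n t \<le> 0" if "t \<in> {0..b}" for n t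
    using that
  proof (induction n arbitrary: t)
    case 0
    have "green k b (\<lambda>s. h (u 0 s) s) t \<le> green k b (\<lambda>_. 0) t"
      by (rule green_mono[OF cont_h[OF cont_u] continuous_on_const k _ 0]) (simp add: u0 upper)
    moreover have "- M \<le> green k b (\<lambda>s. h (u 0 s) s) t"
      by (rule low[OF 0 cont_u]) (simp add: u0 M)
    ultimately show ?case
      unfolding green_const[OF k 0] by (simp add: uS) (simp add: u0)
  next
    case (Suc n)
    have "green k b (\<lambda>s. h (u (Suc n) s) s) t \<le> green k b (\<lambda>s. h (u n s) s) t"
    proof (rule green_mono[OF cont_h[OF cont_u] cont_h[OF cont_u] k _ Suc.prems])
      fix s assume s: "s \<in> {0..b}"
      show "h (u (Suc n) s) s \<le> h (u n s) s"
        using Suc.IH[OF s] by (intro mono s) auto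
    qed
    moreover have "- M \<le> green k b (\<lambda>s. h (u (Suc n) s) s) t"
    proof (rule low[OF Suc.prems cont_u])
      fix s assume "s \<in> {0..b}"
      from Suc.IH[OF this] show "- M \<le> u (Suc n) s \<and> u (Suc n) s \<le> 0" by linarith
    qed
    ultimately show ?case
      unfolding uS[symmetric] using Suc.IH[OF Suc.prems] by linarith
  qed
  have u_range: "- M \<le> u n t" "u n t \<le> 0" if "t \<in> {0..b}" for n t
    using range[OF that, of n] by auto
  have "\<exists>L. (\<lambda>n. u n t) \<longlonglongrightarrow> L" if "t \<in> {0..b}" for t
    using decseq_convergent[of "\<lambda>n. u n t" "- M"] range[OF that] u_range[OF that]
    by (metis decseq_SucI)
  then obtain U where U: "\<And>t. t \<in> {0..b} \<Longrightarrow> (\<lambda>n. u n t) \<longlonglongrightarrow> U t"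
    by metis
  have U_range: "- M \<le> U t \<and> U t \<le> 0" if "t \<in> {0..b}" for t
    using LIMSEQ_le_const[OF U[OF that], of "- M"] LIMSEQ_le_const2[OF U[OF that], of 0]
      u_range[OF that] by blast
  have lim: "(\<lambda>n. h (u n s) s) \<longlonglongrightarrow> h (U s) s" if "s \<in> {0..b}" for s
  proof -
    have "continuous_on UNIV (\<lambda>x. h x s)"
    proof -
      have "continuous_on UNIV (\<lambda>x. (x, s))"
        by (intro continuous_intros)
      from continuous_on_compose2[OF cont this] show ?thesis by simp
    qed
    from continuous_on_tendsto_compose[OF this U[OF that]] show ?thesis by simp
  qed
  have bound: "\<bar>h (u n s) s\<bar> \<le> k\<^sup>2 * M" if "s \<in> {0..b}" for n s
    using mono[of "- M" "u n s" s] mono[of "u n s" 0 s] lower[OF that] upper[OF that]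
      u_range[OF that, of n] that by simp
  note limit = green_limit[OF cont_h[OF cont_u] bound lim k]
  have fixp: "U t = green k b (\<lambda>s. h (U s) s) t" if t: "t \<in> {0..b}" for t
  proof (rule LIMSEQ_unique)
    show "(\<lambda>n. u (Suc n) t) \<longlonglongrightarrow> U t"
      using U[OF t] by (rule LIMSEQ_Suc)
    show "(\<lambda>n. u (Suc n) t) \<longlonglongrightarrow> green k b (\<lambda>s. h (U s) s) t"
      unfolding uS by (rule limit(2)) (use t in auto)
  qed
  \<comment> \<open>Continuity is read off from the fixed-point identity, as \<open>U\<close> is so
    far only a pointwise limit.\<close>
  have "continuous_on {0..b} U"
    by (rule continuous_on_eq[OF limit(1)]) (assumption | rule fixp[symmetric])+
  from that[OF this U_range fixp] show ?thesis .
qed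

lemma half_interval_solution:
  fixes eps lam :: real
  assumes eps: "eps > 0"
  obtains u u' where "u' 0 = 0" "u (pi/2) = 0"
    "\<And>t. t \<in> {0..pi/2} \<Longrightarrow> u t \<le> 0"
    "\<And>t. t \<in> {0..pi/2} \<Longrightarrow> (u has_real_derivative u' t) (at t within {0..pi/2})"
    "\<And>t. t \<in> {0..pi/2} \<Longrightarrow>
      (u' has_real_derivative ((u t)^3 - lam * u t + cos t) / eps\<^sup>2) (at t within {0..pi/2})"
proof -
  \<comment> \<open>With this \<open>M\<close> one has \<open>M * (M\<^sup>2 - lam) \<ge> 1\<close>,
    which makes \<open>- M\<close> a lower solution. The choice of \<open>k\<close> makes
    \<open>k\<^sup>2 * eps\<^sup>2 = 3 * M\<^sup>2 + \<bar>lam\<bar>\<close> dominate the difference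
    quotients of the cubic on \<open>{- M..0}\<close>, so \<open>h\<close> is increasing
    there.\<close>
  define M where "M = 1 + \<bar>lam\<bar>"
  define k where "k = sqrt (3 * M\<^sup>2 + \<bar>lam\<bar>) / eps"
  have M: "M \<ge> 1" by (simp add: M_def)
  have pos: "3 * M\<^sup>2 + \<bar>lam\<bar> > 0"
    using M by (intro add_pos_nonneg) auto
  have k: "k > 0" "k\<^sup>2 = (3 * M\<^sup>2 + \<bar>lam\<bar>) / eps\<^sup>2"
    unfolding k_def power_divide using eps pos by (simp_all only: real_sqrt_gt_zero divide_pos_pos
        real_sqrt_pow2 less_imp_le)
  define h where "h x s = k\<^sup>2 * x - (x^3 - lam * x + cos s) / eps\<^sup>2" for x s
  have h_eps: "h x s * eps\<^sup>2 = (3 * M\<^sup>2 + \<bar>lam\<bar>) * x - (x^3 - lam * x + cos s)" for x s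
  proof -
    have "k\<^sup>2 * eps\<^sup>2 = 3 * M\<^sup>2 + \<bar>lam\<bar>"
      unfolding k(2) using eps by simp
    then have "k\<^sup>2 * x * eps\<^sup>2 = (3 * M\<^sup>2 + \<bar>lam\<bar>) * x"
      by (metis mult.assoc mult.commute)
    then show ?thesis
      unfolding h_def left_diff_distrib using eps by simp
  qed
  have mono: "h x s \<le> h y s" if "- M \<le> x" "x \<le> y" "y \<le> 0" for x y s
  proof -
    have sq: "x\<^sup>2 \<le> M\<^sup>2" "y\<^sup>2 \<le> M\<^sup>2"
      using that power_mono[of "- x" M 2] power_mono[of "- y" M 2] by auto
    moreover have "x * y \<le> M\<^sup>2"
      using sum_squares_bound[of x y] sq by simp
    ultimately have "(y - x) * (3 * M\<^sup>2 + \<bar>lam\<bar> - (x\<^sup>2 + x * y + y\<^sup>2 - lam)) \<ge> 0"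
      using that by (intro mult_nonneg_nonneg) auto
    moreover have "(h y s - h x s) * eps\<^sup>2 =
        (y - x) * (3 * M\<^sup>2 + \<bar>lam\<bar> - (x\<^sup>2 + x * y + y\<^sup>2 - lam))"
      unfolding left_diff_distrib[of "h y s"] h_eps
      by (simp add: algebra_simps power2_eq_square power3_eq_cube)
    ultimately have "(h y s - h x s) * eps\<^sup>2 \<ge> 0" by simp
    then show ?thesis using eps by (simp add: zero_le_mult_iff)
  qed
  \<comment> \<open>The constant 0 is an upper solution only where \<open>cos\<close> is
    nonnegative, hence the restriction to \<open>{0..pi/2}\<close>.\<close>
  have upper: "h 0 s \<le> 0" if "s \<in> {0..pi/2}" for s
    using that eps cos_ge_zero[of s] by (simp add: h_def)
  have lower: "- (k\<^sup>2 * M) \<le> h (- M) s" for s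
  proof -
    have "M * M \<ge> M * 1" using M by (intro mult_left_mono) auto
    then have "M * M - lam \<ge> 1" by (simp add: M_def)
    then have "M * (M * M - lam) \<ge> 1 * 1" using M by (intro mult_mono) auto
    moreover have "cos s \<le> 1" by simp
    ultimately have "M * (M * M - lam) - cos s \<ge> 0" by linarith
    then have "(M * (M * M - lam) - cos s) / eps\<^sup>2 \<ge> 0"
      using eps by (intro divide_nonneg_pos) auto
    moreover have "(- M)^3 - lam * - M + cos s = - (M * (M * M - lam) - cos s)"
      by (simp add: right_diff_distrib power3_eq_cube)
    ultimately show ?thesis
      unfolding h_def by (simp only: minus_divide_left[symmetric] mult_minus_right)
  qed
  have cont: "continuous_on UNIV (\<lambda>p. h (fst p) (snd p))"
    unfolding h_def using eps by (intro continuous_intros) auto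
  obtain u where u: "continuous_on {0..pi/2} u" "\<And>t. t \<in> {0..pi/2} \<Longrightarrow> - M \<le> u t \<and> u t \<le> 0"
    and fixp: "\<And>t. t \<in> {0..pi/2} \<Longrightarrow> u t = green k (pi/2) (\<lambda>s. h (u s) s) t"
  proof (rule monotone_iteration[OF k(1) _ _ cont])
    show "h x s \<le> h y s" if "- M \<le> x" "x \<le> y" "y \<le> 0" "s \<in> {0..pi/2}" for x y s
      using mono that by blast
  qed (use M upper lower in auto)
  define u' where "u' = green' k (pi/2) (\<lambda>s. h (u s) s)"
  have cont_h: "continuous_on {0..pi/2} (\<lambda>s. h (u s) s)"
    unfolding h_def using eps by (intro continuous_intros u(1)) auto
  show ?thesis
  proof (rule that[of u' u])
    show "u' 0 = 0" by (simp add: u'_def green'_def)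
    show "u (pi/2) = 0" by (subst fixp) (auto simp: green_def)
    fix t assume t: "t \<in> {0..pi/2}"
    show "u t \<le> 0" using u t by blast
    show "(u has_real_derivative u' t) (at t within {0..pi/2})"
      unfolding u'_def
      by (rule has_field_derivative_transform_within[OF green_derivs(1)[OF cont_h k(1) t] zero_less_one t])
        (rule fixp[symmetric])
    have "k\<^sup>2 * green k (pi/2) (\<lambda>s. h (u s) s) t - h (u t) t =
        ((u t)^3 - lam * u t + cos t) / eps\<^sup>2"
      using fixp[OF t] by (simp add: h_def)
    with green_derivs(2)[OF cont_h k(1) t]
    show "(u' has_real_derivative ((u t)^3 - lam * u t + cos t) / eps\<^sup>2) (at t within {0..pi/2})"
      by (simp add: u'_def)
  qed
qed

section \<open>The odd solution about pi/2\<close>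

lemma continuous_antiderivative:
  fixes f :: "real \<Rightarrow> real"
  assumes f: "continuous_on UNIV f"
  obtains F where "F a = c" "\<And>t. (F has_real_derivative f t) (at t)"
proof -
  define G where "G u = (LBINT y=0..u. f y)" for u :: real
  have G: "(G has_real_derivative f t) (at t)" for t
  proof -
    \<comment> \<open>This compact interval contains both the base point 0 and \<open>t\<close> in
      its interior, so the derivative within it is the full one.\<close>
    have "(G has_vector_derivative f t) (at t within {- \<bar>t\<bar> - 1..\<bar>t\<bar> + 1})"
      unfolding G_def[abs_def]
      using interval_integral_FTC2[of "- \<bar>t\<bar> - 1" 0 "\<bar>t\<bar> + 1" f t] continuous_on_subset[OF f]
      by (auto simp: zero_ereal_def)
    moreover have "at t within {- \<bar>t\<bar> - 1..\<bar>t\<bar> + 1} = at t"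
      by (rule at_within_interior) (auto simp: interior_atLeastAtMost_real)
    ultimately show ?thesis
      by (simp add: has_real_derivative_iff_has_vector_derivative)
  qed
  have "((\<lambda>t. G t - G a + c) has_real_derivative f t) (at t)" for t
    by (rule derivative_eq_intros G refl)+ simp
  with that[of "\<lambda>t. G t - G a + c"] show ?thesis by simp
qed

lemma second_derivative_zero:
  fixes D D' :: "real \<Rightarrow> real"
  assumes "\<And>t. (D has_real_derivative D' t) (at t)" "\<And>t. (D' has_real_derivative 0) (at t)"
    and "D a = 0" "D' a = 0"
  shows "D t = 0"
  using linear_ode_zero[of D D' "\<lambda>_. 0" a t] assms by simp

text \<open>\<open>arccos (cos t)\<close> equals \<open>t\<close> up to sign and multiples of
  \<open>2 * pi\<close>; identities between such functions need checking only on
  \<open>{0..pi}\<close>.\<close>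

lemma even_periodic_arccos_cos:
  fixes f :: "real \<Rightarrow> 'a"
  assumes even: "\<And>t. f (- t) = f t" and per: "\<And>t. f (t + 2 * pi) = f t"
  shows "f (arccos (cos t)) = f t"
proof -
  interpret periodic_fun_simple f "2 * pi"
    by standard (rule per)
  have shift: "f (x + 2 * of_int n * pi) = f x" for x n
    using plus_of_int[of x n] by (simp add: mult_ac)
  have "cos (arccos (cos t)) = cos t" by simp
  then obtain n where "arccos (cos t) = t + 2 * of_int n * pi \<or> arccos (cos t) = - t + 2 * of_int n * pi"
    unfolding cos_eq by (auto elim!: Ints_cases)
  then show ?thesis
    using shift[of t n] shift[of "- t" n] even[of t] by metis
qed

lemma nonpositive_odd_solution:
  fixes eps lam :: real
  assumes eps: "eps > 0"
  obtains v where "is_solution eps lam v" "deriv v 0 = 0" "v (pi/2) = 0" "periodic_2pi v"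
    "\<And>t. t \<in> {0..pi/2} \<Longrightarrow> v t \<le> 0"
proof -
  obtain u u' where u'0: "u' 0 = 0" and u_end: "u (pi/2) = 0"
    and u_le: "\<And>t. t \<in> {0..pi/2} \<Longrightarrow> u t \<le> 0"
    and u: "\<And>t. t \<in> {0..pi/2} \<Longrightarrow> (u has_real_derivative u' t) (at t within {0..pi/2})"
    and u': "\<And>t. t \<in> {0..pi/2} \<Longrightarrow>
      (u' has_real_derivative ((u t)^3 - lam * u t + cos t) / eps\<^sup>2) (at t within {0..pi/2})"
    using half_interval_solution[OF eps] by metis
  have cont_u: "continuous_on {0..pi/2} u"
    using u by (rule DERIV_continuous_on)
  \<comment> \<open>The reflected extension is written as a function of \<open>cos t\<close>.
    Evenness and periodicity are then automatic, and antisymmetry about \<open>pi/2\<close> is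
    oddness of \<open>G\<close>; the two branches meet because \<open>u (pi/2) = 0\<close>.\<close>
  define G where "G x = (if x \<le> 0 then - u (arccos (- x)) else u (arccos x))" for x
  have arccos_range: "arccos x \<in> {0..pi/2}" if "0 \<le> x" "x \<le> 1" for x
    using that arccos_lbound[of x] arccos_le_pi2[of x] by auto
  have "continuous_on ({-1..0} \<union> {0..1}) G"
    unfolding G_def
  proof (rule continuous_on_cases)
    show "continuous_on {-1..0} (\<lambda>x. - u (arccos (- x)))"
      by (intro continuous_intros continuous_on_compose2[OF cont_u] continuous_on_arccos)
        (use arccos_range in \<open>force+\<close>)
    show "continuous_on {0..1} (\<lambda>x. u (arccos x))"
      by (intro continuous_on_compose2[OF cont_u] continuous_on_arccos continuous_intros)
        (use arccos_range in \<open>force+\<close>)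
  qed (use u_end in auto)
  moreover have "{-1..0} \<union> {0..1} = {-1..1::real}" by auto
  ultimately have cont_G: "continuous_on {-1..1} G" by simp
  have G_odd: "G (- x) = - G x" for x
    using u_end by (simp add: G_def)
  define e where "e t = G (cos t)" for t
  have cont_e: "continuous_on UNIV e"
    unfolding e_def by (intro continuous_on_compose2[OF cont_G] continuous_intros) auto
  have e_even: "e (- t) = e t" and e_anti: "e (pi - t) = - e t" for t
    by (simp_all add: e_def G_odd)
  have e_u: "e t = u t" if t: "t \<in> {0..pi/2}" for t
  proof (cases "t = pi/2")
    case True
    show ?thesis unfolding True by (simp add: e_def G_def u_end)
  next
    case False
    then have "cos t > 0" using t by (intro cos_gt_zero_pi) auto
    then show ?thesis using t by (simp add: e_def G_def arccos_cos)
  qed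
  define F where "F t = ((e t)^3 - lam * e t + cos t) / eps\<^sup>2" for t
  have cont_F: "continuous_on UNIV F"
    unfolding F_def using eps by (intro continuous_intros cont_e) auto
  have F_even: "F (- t) = F t" for t
    by (simp add: F_def e_even)
  have F_anti: "F (pi - t) = - F t" for t
    unfolding F_def e_anti minus_divide_left by simp
  \<comment> \<open>Rather than gluing derivatives of the reflected function \<open>e\<close>, integrate its right-hand side twice;
    the result \<open>V\<close> inherits the symmetries and agrees with \<open>e\<close> on \<open>[0, pi/2]\<close>, hence everywhere.\<close>
  obtain P where P0: "P 0 = 0" and P: "\<And>t. (P has_real_derivative F t) (at t)"
    using continuous_antiderivative[OF cont_F] by metis
  then have "continuous_on UNIV P"
    by (meson DERIV_isCont continuous_at_imp_continuous_on)
  then obtain V where V0: "V 0 = u 0" and V: "\<And>t. (V has_real_derivative P t) (at t)"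
    using continuous_antiderivative by metis
  have mirror: "((\<lambda>s. f (- s)) has_real_derivative - f' (- s)) (at s)"
    if "\<And>s. (f has_real_derivative f' s) (at s)" for f f' :: "real \<Rightarrow> real" and s
    by (rule DERIV_mirror[THEN iffD1, OF that])
  have shift: "((\<lambda>s. f (pi - s)) has_real_derivative - f' (pi - s)) (at s)"
    if "\<And>s. (f has_real_derivative f' s) (at s)" for f f' :: "real \<Rightarrow> real" and s
    by (rule DERIV_cong[OF DERIV_chain2[OF that]]) (auto intro!: derivative_eq_intros)
  have V_even: "V (- t) = V t" for t
  proof -
    have "V t - V (- t) = 0"
    proof (rule second_derivative_zero[of "\<lambda>t. V t - V (- t)" "\<lambda>s. P s + P (- s)" 0])
      show "((\<lambda>t. V t - V (- t)) has_real_derivative P s + P (- s)) (at s)" for s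
        using DERIV_diff[OF V mirror[OF V]] by simp
      show "((\<lambda>s. P s + P (- s)) has_real_derivative 0) (at s)" for s
        using DERIV_add[OF P mirror[OF P]] by (simp add: F_even)
    qed (use P0 in auto)
    then show ?thesis by simp
  qed
  have V_u: "V t = u t" if t: "t \<in> {0..pi/2}" for t
  proof -
    have "((\<lambda>t. P t - u' t) has_real_derivative 0) (at s within {0..pi/2})" if "s \<in> {0..pi/2}" for s
      using DERIV_diff[OF DERIV_subset[OF P subset_UNIV] u'[OF that]] e_u[OF that] by (simp add: F_def)
    then obtain c where c: "\<And>s. s \<in> {0..pi/2} \<Longrightarrow> P s - u' s = c"
      using has_field_derivative_zero_constant[of "{0..pi/2}"] convex_real_interval(5) by metis
    then have Pu': "P s = u' s" if "s \<in> {0..pi/2}" for s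
      using c[of 0] c[OF that] P0 u'0 by simp
    have "((\<lambda>t. V t - u t) has_real_derivative 0) (at s within {0..pi/2})" if "s \<in> {0..pi/2}" for s
      using DERIV_diff[OF DERIV_subset[OF V subset_UNIV] u[OF that]] Pu'[OF that] by simp
    then obtain c where "\<And>s. s \<in> {0..pi/2} \<Longrightarrow> V s - u s = c"
      using has_field_derivative_zero_constant[of "{0..pi/2}"] convex_real_interval(5) by metis
    from this[of 0] this[of t] t V0 show ?thesis by simp
  qed
  have V_anti: "V (pi - t) = - V t" for t
  proof -
    \<comment> \<open>The anchor point is \<open>pi/2\<close>, fixed by
      \<open>t \<mapsto> pi - t\<close>: the slope of the sum cancels there, and its value is
      \<open>2 * u (pi/2) = 0\<close>.\<close>
    have "V t + V (pi - t) = 0"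
    proof (rule second_derivative_zero[of "\<lambda>t. V t + V (pi - t)" "\<lambda>s. P s - P (pi - s)" "pi/2"])
      show "((\<lambda>t. V t + V (pi - t)) has_real_derivative P s - P (pi - s)) (at s)" for s
        using DERIV_add[OF V shift[OF V]] by simp
      show "((\<lambda>s. P s - P (pi - s)) has_real_derivative 0) (at s)" for s
        using DERIV_diff[OF P shift[OF P]] by (simp add: F_anti)
    qed (use V_u[of "pi/2"] u_end in auto)
    then show ?thesis by simp
  qed
  \<comment> \<open>Evenness and antisymmetry compose to \<open>V (t + pi) = - V t\<close>; two such
    steps give the period.\<close>
  have V_per: "V (t + 2 * pi) = V t" for t
    using V_anti[of "- (t + pi)"] V_anti[of "- t"] V_even[of t] V_even[of "t + pi"]
    by (simp add: algebra_simps)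
  have V_e: "V t = e t" for t
  proof -
    have e_arccos: "e (arccos (cos t)) = e t"
      by (simp add: e_def)
    have half: "V s = e s" if "0 \<le> s" "s \<le> pi" for s
    proof (cases "s \<le> pi/2")
      case True
      then show ?thesis using V_u[of s] e_u[of s] that by simp
    next
      case False
      then have "V (pi - s) = e (pi - s)" using V_u[of "pi - s"] e_u[of "pi - s"] that by simp
      then show ?thesis by (simp add: V_anti e_anti)
    qed
    have "V (arccos (cos t)) = e (arccos (cos t))"
      using half arccos_lbound[of "cos t"] arccos_ubound[of "cos t"] by simp
    then show ?thesis
      using even_periodic_arccos_cos[of V, OF V_even V_per] e_arccos by simp
  qed
  have sol: "is_solution eps lam V" "deriv V = P"
    using is_solutionI[OF V _ eps, of lam] P by (auto simp: F_def V_e)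
  show ?thesis
    by (rule that[of V]) (use sol V_u u_end u_le P0 V_per in \<open>auto simp: periodic_2pi_def\<close>)
qed

section \<open>Monotonicity and uniqueness of the middle solution\<close>

lemma up_exists:
  fixes eps lam :: real
  assumes eps: "eps > 0"
  shows "\<exists>v. is_up eps lam v"
proof -
  obtain v where v: "is_solution eps lam v" and v0: "deriv v 0 = 0" and v_end: "v (pi/2) = 0"
    and per: "periodic_2pi v" and v_le: "\<And>t. t \<in> {0..pi/2} \<Longrightarrow> v t \<le> 0"
    using nonpositive_odd_solution[OF eps] by blast
  note D1 = solution_derivs(1)[OF v eps] and D2 = solution_derivs(2)[OF v eps]
    and D3 = solution_third_deriv[OF v eps]
  \<comment> \<open>A zero before \<open>pi/2\<close> would be a local maximum, at
    \<open>t = 0\<close> too thanks to evenness, but there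
    \<open>eps\<^sup>2 * v'' = cos t > 0\<close>.\<close>
  have neg: "v t < 0" if t: "t \<in> {0..<pi/2}" for t
  proof (rule ccontr)
    assume "\<not> v t < 0"
    then have vt: "v t = 0" using v_le[of t] t by simp
    have le: "v s \<le> v t" if "\<bar>s - t\<bar> < pi/2 - t" for s
    proof -
      have "v \<bar>s\<bar> \<le> 0" using that t by (intro v_le) auto
      then show ?thesis
        using solution_even(1)[OF v eps v0, of s] vt by (auto simp: abs_if split: if_splits)
    qed
    have "((v t)^3 - lam * v t + cos t) / eps\<^sup>2 \<le> 0"
      by (rule second_deriv_at_local_max(2)[OF D1 D2 _ le]) (use t in auto)
    moreover have "cos t > 0" using t by (intro cos_gt_zero_pi) auto
    ultimately show False using vt eps by (simp add: divide_le_0_iff)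
  qed
  have slope_end: "deriv v (pi/2) \<ge> 0"
  proof (rule ccontr)
    assume "\<not> deriv v (pi/2) \<ge> 0"
    then obtain r where "r > 0" and r: "\<And>h. 0 < h \<Longrightarrow> h < r \<Longrightarrow> v (pi/2) < v (pi/2 - h)"
      using DERIV_neg_dec_left[OF D1, of "pi/2"] by force
    define h where "h = min r (pi/2) / 2"
    have "0 < h" "h < r" "h < pi/2" using \<open>r > 0\<close> pi_gt_zero by (auto simp: h_def min_def)
    with r[of h] neg[of "pi/2 - h"] v_end show False by auto
  qed
  have mD1: "((\<lambda>t. - v t) has_real_derivative - deriv v t) (at t)"
    and mD2: "((\<lambda>t. - deriv v t) has_real_derivative - (((v t)^3 - lam * v t + cos t) / eps\<^sup>2)) (at t)"
    for t using DERIV_minus[OF D1] DERIV_minus[OF D2] by blast+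
  \<comment> \<open>The comparison is applied to \<open>z = v'\<close> with weight
    \<open>p = - v\<close>. The terms in \<open>lam\<close> cancel, leaving \<open>(sin s * v s +
    deriv v s * (cos s - 2 * (v s)^3)) / eps\<^sup>2\<close>, both parts of which are negative where
    \<open>v' < 0\<close>.\<close>
  have ge: "deriv v t \<ge> 0" if "t \<in> {0..pi/2}" for t
  proof (rule wronskian_comparison[OF D2 D3 mD1 mD2 _ _ _ slope_end that])
    fix s :: real assume s: "s \<in> {0<..<pi/2}" and less: "deriv v s < 0"
    have "v s < 0" "sin s > 0" "cos s > 0"
      using neg[of s] s by (auto intro!: sin_gt_zero cos_gt_zero_pi)
    have "v s ^ 3 < 0"
      using \<open>v s < 0\<close> by (simp add: power_less_zero_eq)
    then have "cos s - 2 * (v s)^3 > 0"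
      using \<open>cos s > 0\<close> by linarith
    with less have "deriv v s * (cos s - 2 * (v s)^3) < 0"
      by (rule mult_neg_pos)
    moreover have "sin s * v s < 0" using \<open>v s < 0\<close> \<open>sin s > 0\<close> by (rule mult_pos_neg[rotated])
    moreover have "((3 * (v s)\<^sup>2 - lam) * deriv v s - sin s) / eps\<^sup>2 * - v s -
        deriv v s * - (((v s)^3 - lam * v s + cos s) / eps\<^sup>2) =
        (sin s * v s + deriv v s * (cos s - 2 * (v s)^3)) / eps\<^sup>2"
      using eps by (simp add: field_simps power2_eq_square power3_eq_cube)
    ultimately show "((3 * (v s)\<^sup>2 - lam) * deriv v s - sin s) / eps\<^sup>2 * - v s -
        deriv v s * - (((v s)^3 - lam * v s + cos s) / eps\<^sup>2) < 0"
      using eps by (simp add: divide_less_0_iff)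
  qed (use v_le v0 in auto)
  have "deriv v t > 0" if t: "t \<in> {0<..<pi/2}" for t
  proof (rule ccontr)
    assume "\<not> deriv v t > 0"
    then have vt: "deriv v t = 0" using ge[of t] t by simp
    \<comment> \<open>A zero of the nonnegative function \<open>v'\<close> is a minimum, whereas its
      second derivative there is \<open>- sin t / eps\<^sup>2 < 0\<close>.\<close>
    have "((3 * (v t)\<^sup>2 - lam) * deriv v t - sin t) / eps\<^sup>2 \<ge> 0"
      by (rule second_deriv_at_local_min(2)[OF D2 D3, of "min t (pi/2 - t)"])
        (use t vt in \<open>auto intro!: ge\<close>)
    moreover have "sin t / eps\<^sup>2 > 0"
      using t eps by (intro divide_pos_pos sin_gt_zero) auto
    ultimately show False using vt by simp
  qed
  with v v0 v_end per show ?thesis by (auto simp: is_up_def)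
qed

lemma up_neg:
  assumes "is_up eps lam v" and eps: "eps > 0" and t: "0 \<le> t" "t < pi/2"
  shows "v t < 0"
proof -
  have v: "is_solution eps lam v" "v (pi/2) = 0" "\<forall>t\<in>{0<..<pi/2}. deriv v t > 0"
    using assms by (auto simp: is_up_def)
  have "v t < v (pi/2)"
    by (rule DERIV_pos_imp_increasing_open[OF t(2)])
      (use v t solution_derivs(1)[OF v(1) eps] solution_continuous[OF v(1)] in force)+
  with v show ?thesis by simp
qed

lemma up_le:
  assumes u: "is_up eps lam u" and v: "is_up eps lam v" and eps: "eps > 0"
    and t: "t \<in> {0..pi/2}"
  shows "v t \<le> u t"
proof -
  have u': "is_solution eps lam u" "deriv u 0 = 0" "u (pi/2) = 0"
    and v': "is_solution eps lam v" "deriv v 0 = 0" "v (pi/2) = 0"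
    using u v by (auto simp: is_up_def)
  note D = solution_derivs[OF v'(1) eps]
  have mD1: "((\<lambda>t. - v t) has_real_derivative - deriv v t) (at t)"
    and mD2: "((\<lambda>t. - deriv v t) has_real_derivative - (((v t)^3 - lam * v t + cos t) / eps\<^sup>2)) (at t)"
    for t using DERIV_minus[OF D(1)] DERIV_minus[OF D(2)] by blast+
  have "u t - v t \<ge> 0"
  \<comment> \<open>Weight \<open>- v\<close>, with the derivative alternative at 0 since both
    solutions have slope 0 there. The coefficient \<open>lam\<close> cancels from the Wronskian
    identity, so the argument covers every real \<open>lam\<close>.\<close>
  proof (rule wronskian_comparison[OF solution_diff_derivs[OF u'(1) v'(1) eps] mD1 mD2 _ _ _ _ t])
    fix s assume s: "s \<in> {0..pi/2}"
    show "0 \<le> - v s"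
    proof (cases "s = pi/2")
      case True
      then show ?thesis unfolding True using v' by simp
    next
      case False
      then show ?thesis using up_neg[OF v eps, of s] s by simp
    qed
  next
    fix s :: real assume s: "s \<in> {0<..<pi/2}" and less: "u s - v s < 0"
    have neg: "u s < 0" "v s < 0" "cos s > 0"
      using up_neg[OF u eps, of s] up_neg[OF v eps, of s] s by (auto intro!: cos_gt_zero_pi)
    have "u s * v s * (u s + v s) < 0"
      using neg by (intro mult_pos_neg mult_neg_neg) auto
    then have "cos s - u s * v s * (u s + v s) > 0"
      using neg by linarith
    with less have "(u s - v s) * (cos s - u s * v s * (u s + v s)) < 0"
      by (rule mult_neg_pos)
    moreover have "((u s)\<^sup>2 + u s * v s + (v s)\<^sup>2 - lam) / eps\<^sup>2 * (u s - v s) * - v s -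
        (u s - v s) * - (((v s)^3 - lam * v s + cos s) / eps\<^sup>2) =
        (u s - v s) * (cos s - u s * v s * (u s + v s)) / eps\<^sup>2"
      using eps by (simp add: field_simps power2_eq_square power3_eq_cube)
    ultimately show "((u s)\<^sup>2 + u s * v s + (v s)\<^sup>2 - lam) / eps\<^sup>2 * (u s - v s) * - v s -
        (u s - v s) * - (((v s)^3 - lam * v s + cos s) / eps\<^sup>2) < 0"
      using eps by (simp add: divide_less_0_iff)
  qed (use u' v' in auto)
  then show ?thesis by simp
qed

lemma up_unique:
  assumes u: "is_up eps lam u" and v: "is_up eps lam v" and eps: "eps > 0"
  shows "u = v"
proof (rule solution_unique[OF _ _ eps, of lam _ _ 0])
  show "u 0 = v 0"
    using up_le[OF u v eps, of 0] up_le[OF v u eps, of 0] by simp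
qed (use u v in \<open>auto simp: is_up_def\<close>)

section \<open>Bounded solutions on the half-line and on the whole line\<close>

lemma periodic_2pi_bounded:
  assumes "periodic_2pi u" and "continuous_on UNIV u"
  shows "bounded (range u)"
proof -
  interpret periodic_fun_simple u "2 * pi"
    by standard (use assms in \<open>simp add: periodic_2pi_def\<close>)
  have "u t \<in> u ` {0..2 * pi}" for t
  proof
    define n where "n = \<lfloor>t / (2 * pi)\<rfloor>"
    show "u t = u (t - of_int n * (2 * pi))" by (simp add: minus_of_int)
    have "of_int n \<le> t / (2 * pi)" "t / (2 * pi) \<le> of_int n + 1"
      unfolding n_def by linarith+
    then show "t - of_int n * (2 * pi) \<in> {0..2 * pi}"
      by (simp add: field_simps)
  qed
  moreover have "bounded (u ` {0..2 * pi})"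
    by (intro compact_imp_bounded compact_continuous_image continuous_on_subset[OF assms(2)]) auto
  ultimately show ?thesis
    by (meson bounded_subset image_subsetI)
qed

text \<open>For \<open>lam \<le> 0\<close> the coefficient
  \<open>u\<^sup>2 + u * v + v\<^sup>2 - lam\<close> is positive wherever \<open>u\<close> and
  \<open>v\<close> differ. Both slopes vanish at 0, so a difference that is negative there would be
  unbounded.\<close>

lemma half_line_solution_unique:
  assumes u: "bounded_half_line_solution eps lam u" and v: "bounded_half_line_solution eps lam v"
    and eps: "eps > 0" and lam: "lam \<le> 0"
  shows "u = v"
proof -
  have *: "\<not> u 0 < v 0"
    if u: "bounded_half_line_solution eps lam u" and v: "bounded_half_line_solution eps lam v"
    for u v
  proof
    assume less: "u 0 < v 0"
    have u': "is_solution eps lam u" "deriv u 0 = 0" "bounded (u ` {0..})"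
      and v': "is_solution eps lam v" "deriv v 0 = 0" "bounded (v ` {0..})"
      using u v by (auto simp: bounded_half_line_solution_def)
    show False
    proof (rule concave_where_negative_escapes[OF solution_diff_derivs[OF u'(1) v'(1) eps]])
      fix t assume "u t - v t < 0"
      then have "(u t)\<^sup>2 + (v t)\<^sup>2 > 0"
        by (auto simp: sum_power2_gt_zero_iff)
      then have "((u t + v t)\<^sup>2 + ((u t)\<^sup>2 + (v t)\<^sup>2)) / 2 > 0"
        by (rule half_gt_zero[OF add_nonneg_pos[OF zero_le_power2]])
      also have "((u t + v t)\<^sup>2 + ((u t)\<^sup>2 + (v t)\<^sup>2)) / 2 = (u t)\<^sup>2 + u t * v t + (v t)\<^sup>2"
        by (simp add: power2_eq_square algebra_simps)
      finally have "(u t)\<^sup>2 + u t * v t + (v t)\<^sup>2 - lam > 0"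
        using lam by simp
      with \<open>u t - v t < 0\<close> show "((u t)\<^sup>2 + u t * v t + (v t)\<^sup>2 - lam) / eps\<^sup>2 * (u t - v t) < 0"
        using eps by (intro mult_pos_neg divide_pos_pos) auto
    qed (use less u' v' in \<open>auto intro: bounded_minus_comp\<close>)
  qed
  have "u 0 = v 0" using *[OF u v] *[OF v u] by simp
  then show ?thesis
    using u v by (intro solution_unique[OF _ _ eps]) (auto simp: bounded_half_line_solution_def)
qed

lemma half_line_solution_abs:
  assumes "bounded_half_line_solution eps lam u" and "eps > 0"
  shows "u \<bar>t\<bar> = u t"
  using solution_even(1)[of eps lam u t] assms
  by (auto simp: bounded_half_line_solution_def abs_if)

lemma half_line_solution_bounded:
  assumes u: "bounded_half_line_solution eps lam u" and eps: "eps > 0"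
  shows "bounded_solution eps lam u"
proof -
  have "u t \<in> u ` {0..}" for t
    using half_line_solution_abs[OF u eps, of t] by (intro image_eqI[of _ _ "\<bar>t\<bar>"]) auto
  then have "range u \<subseteq> u ` {0..}" by blast
  with u show ?thesis
    by (auto simp: bounded_half_line_solution_def bounded_solution_def intro: bounded_subset)
qed

lemma bounded_solution_shift:
  assumes "bounded_solution eps lam u" and "eps > 0"
  shows "bounded_solution eps lam (\<lambda>t. u (t + 2 * pi))"
  using assms solution_shift[of eps lam u]
  by (auto simp: bounded_solution_def intro: bounded_subset)

lemma bounded_solution_antishift:
  assumes "bounded_solution eps lam u" and "eps > 0"
  shows "bounded_solution eps lam (\<lambda>t. - u (t + pi))"
proof -
  have "bounded (range (\<lambda>t. - u (t + pi)))"
    using assms by (auto simp: bounded_solution_def bounded_iff)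
  with assms solution_antishift[of eps lam u] show ?thesis
    by (simp add: bounded_solution_def)
qed

lemma outer_solution_unique:
  assumes u: "bounded_solution eps lam u" and v: "bounded_solution eps lam v" and eps: "eps > 0"
    and "\<And>t. u t < 0 \<and> 3 * (u t)\<^sup>2 - lam > 0" "\<And>t. v t < 0 \<and> 3 * (v t)\<^sup>2 - lam > 0"
  shows "u = v"
  using bounded_solution_below[OF u v eps] bounded_solution_below[OF v u eps] assms(4,5)
  by (intro ext antisym) blast+

section \<open>Symmetry, ordering and the middle solution, combined from the comparison
  results\<close>

theorem theorem6:
  fixes eps :: real
  assumes "eps > 0"
  shows
    "(\<forall>lam u1 u5.
        lam > 3 / 2 powr (2/3) \<and>
        bounded_half_line_solution eps lam u1 \<and>
        (\<forall>t\<ge>0. u1 t < 0 \<and> 3 * (u1 t)^2 - lam > 0) \<and>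
        bounded_half_line_solution eps lam u5 \<and>
        (\<forall>t\<ge>0. u5 t > 0 \<and> 3 * (u5 t)^2 - lam > 0)
        \<longrightarrow>
        periodic_2pi u1 \<and> periodic_2pi u5 \<and>
        (\<forall>t\<in>{0<..<pi}. deriv u1 t > 0) \<and>
        (\<forall>t\<in>{0..pi}. U_lower lam 0 < u1 t \<and> u1 t < U_lower lam pi) \<and>
        (\<forall>t. u5 t = - u1 (t + pi)) \<and>
        bounded_solution eps lam u1 \<and> bounded_solution eps lam u5 \<and>
        (\<forall>v. bounded_solution eps lam v \<and> v \<noteq> u1 \<and> v \<noteq> u5
              \<longrightarrow> (\<forall>t. u1 t < v t \<and> v t < u5 t)) \<and>
        (\<exists>up. is_up eps lam up \<and> up \<noteq> u1 \<and> up \<noteq> u5)) \<and>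
     (\<forall>lam. \<exists>!up. is_up eps lam up) \<and>
     (\<forall>lam up. lam \<le> 0 \<and> is_up eps lam up
        \<longrightarrow> (\<forall>v. bounded_half_line_solution eps lam v \<longleftrightarrow> v = up))"
proof (rule conjI[OF _ conjI]; intro allI impI)
  note eps = \<open>eps > 0\<close>
  fix lam u1 u5
  assume *: "lam > 3 / 2 powr (2/3) \<and>
      bounded_half_line_solution eps lam u1 \<and>
      (\<forall>t\<ge>0. u1 t < 0 \<and> 3 * (u1 t)^2 - lam > 0) \<and>
      bounded_half_line_solution eps lam u5 \<and>
      (\<forall>t\<ge>0. u5 t > 0 \<and> 3 * (u5 t)^2 - lam > 0)"
  then have lam: "lam > 3 / 2 powr (2/3)"
    and half1: "bounded_half_line_solution eps lam u1"
    and half5: "bounded_half_line_solution eps lam u5" by auto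
  \<comment> \<open>Evenness carries the sign conditions from the half-line to the whole
    line.\<close>
  have neg1: "u1 t < 0 \<and> 3 * (u1 t)\<^sup>2 - lam > 0" for t
    using * half_line_solution_abs[OF half1 eps, of t] by (metis abs_ge_zero)
  have pos5: "u5 t > 0 \<and> 3 * (u5 t)\<^sup>2 - lam > 0" for t
    using * half_line_solution_abs[OF half5 eps, of t] by (metis abs_ge_zero)
  have sol1: "is_solution eps lam u1" "deriv u1 0 = 0"
    using half1 by (auto simp: bounded_half_line_solution_def)
  have bdd1: "bounded_solution eps lam u1" and bdd5: "bounded_solution eps lam u5"
    using half_line_solution_bounded half1 half5 eps by blast+
  \<comment> \<open>The shifted function is again a bounded solution with the same sign conditions,
    so uniqueness yields the period; the relation to \<open>u5\<close> arises in the same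
    way.\<close>
  have "(\<lambda>t. u1 (t + 2 * pi)) = u1"
    by (rule outer_solution_unique[OF bounded_solution_shift[OF bdd1 eps] bdd1 eps neg1 neg1])
  then have per1': "u1 (t + 2 * pi) = u1 t" for t
    by (rule fun_cong)
  then have per1: "periodic_2pi u1"
    by (simp add: periodic_2pi_def)
  have "(\<lambda>t. - u5 (t + pi)) = u1"
    by (rule outer_solution_unique[OF bounded_solution_antishift[OF bdd5 eps] bdd1 eps _ neg1])
      (use pos5 in auto)
  then have u5_u1: "u5 t = - u1 (t - pi)" for t
    using fun_cong[of _ _ "t - pi"] by fastforce
  have shift1: "u1 (t - pi) = u1 (t + pi)" for t
    using per1'[of "t - pi"] by (simp add: add.commute)
  have per5: "periodic_2pi u5"
    using shift1[of "t + pi" for t] by (simp add: periodic_2pi_def u5_u1 shift1 per1' algebra_simps)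
  \<comment> \<open>The derivative is odd and \<open>2 * pi\<close>-periodic, so its values at
    \<open>pi\<close> and \<open>- pi\<close> are both equal and opposite.\<close>
  have "deriv u1 pi = 0"
    using periodic_2pi_deriv[OF sol1(1) eps per1, of "- pi"] solution_even(2)[OF sol1(1) eps sol1(2), of pi]
    by simp
  note ends = sol1(2) this
  have incr: "\<forall>t\<in>{0<..<pi}. deriv u1 t > 0"
    using outer_solution_increasing[OF sol1(1) eps _ ends] neg1 by simp
  have bounds: "\<forall>t\<in>{0..pi}. U_lower lam 0 < u1 t \<and> u1 t < U_lower lam pi"
    using outer_solution_bounds[OF sol1(1) eps lam neg1 ends] by simp
  have between: "u1 t < v t \<and> v t < u5 t"
    if v: "bounded_solution eps lam v" "v \<noteq> u1" "v \<noteq> u5" for v t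
  proof
    show "u1 t < v t"
      by (rule bounded_solution_below_strict[OF bdd1 v(1) eps neg1 v(2)])
    \<comment> \<open>Maximality of \<open>u5\<close> is minimality of \<open>u1\<close> applied to
      the antishift of \<open>v\<close>; that antishift equals \<open>u1\<close> only if
      \<open>v = u5\<close>.\<close>
    have "(\<lambda>t. - v (t + pi)) \<noteq> u1"
    proof
      assume "(\<lambda>t. - v (t + pi)) = u1"
      then have "u5 t = v t" for t
        using fun_cong[of "\<lambda>t. - v (t + pi)" u1 "t - pi"] u5_u1[of t] by simp
      with v(3) show False by auto
    qed
    from bounded_solution_below_strict[OF bdd1 bounded_solution_antishift[OF v(1) eps] eps neg1 this]
    show "v t < u5 t"
      using u5_u1[of t] by (metis diff_add_cancel neg_less_iff_less minus_minus)
  qed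
  obtain up where up: "is_up eps lam up"
    using up_exists[OF eps] by blast
  \<comment> \<open>\<open>up\<close> vanishes at \<open>pi/2\<close>, while \<open>u1\<close> is
    negative and \<open>u5\<close> positive everywhere.\<close>
  then have "up \<noteq> u1" "up \<noteq> u5"
    using neg1[of "pi/2"] pos5[of "pi/2"] by (auto simp: is_up_def)
  with up per1 per5 incr bounds u5_u1 shift1 bdd1 bdd5 between
  show "periodic_2pi u1 \<and> periodic_2pi u5 \<and>
      (\<forall>t\<in>{0<..<pi}. deriv u1 t > 0) \<and>
      (\<forall>t\<in>{0..pi}. U_lower lam 0 < u1 t \<and> u1 t < U_lower lam pi) \<and>
      (\<forall>t. u5 t = - u1 (t + pi)) \<and>
      bounded_solution eps lam u1 \<and> bounded_solution eps lam u5 \<and>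
      (\<forall>v. bounded_solution eps lam v \<and> v \<noteq> u1 \<and> v \<noteq> u5
            \<longrightarrow> (\<forall>t. u1 t < v t \<and> v t < u5 t)) \<and>
      (\<exists>up. is_up eps lam up \<and> up \<noteq> u1 \<and> up \<noteq> u5)"
    by auto
next
  fix lam
  show "\<exists>!up. is_up eps lam up"
    using up_exists[OF assms] up_unique[OF _ _ assms] by blast
next
  fix lam up v
  assume *: "lam \<le> 0 \<and> is_up eps lam up"
  then have up: "is_solution eps lam up" "deriv up 0 = 0" "periodic_2pi up"
    by (auto simp: is_up_def)
  then have "bounded (up ` {0..})"
    using periodic_2pi_bounded[OF up(3) solution_continuous[OF up(1)]] by (auto intro: bounded_subset)
  with up have "bounded_half_line_solution eps lam up"
    by (simp add: bounded_half_line_solution_def)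
  then show "bounded_half_line_solution eps lam v \<longleftrightarrow> v = up"
    using half_line_solution_unique[OF _ _ assms] * by blast
qed

end
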